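(* Let $\mathfrak g$ be the Lie algebra attached to $(\mathfrak h,(\cdot,\cdot),\alpha_1,\dots,\alpha_R)$, $\sigma$ a diagram automorphism of order $T$, $\tilde{\mathfrak g}=\mathfrak g/\ker S_{\mathfrak g}$, $\tilde{\mathfrak g}^\sigma$ its fixed-point subalgebra, and let $\Omega$ be the cocycle defined in the context, regarded as a cocycle on $\tilde{\mathfrak g}^\sigma$. If $\Omega$ is a coboundary, i.e. if there is a linear map $\alpha:\tilde{\mathfrak g}^\sigma\to\mathbb C$ with $\Omega(x,y)=\alpha([x,y])$ for all $x,y\in\tilde{\mathfrak g}^\sigma$, then $\Omega=0$.
   Context: Lie algebra. $\mathfrak h$ is a finite-dimensional complex vector space with non-degenerate symmetric bilinear form $(\cdot,\cdot)$ (inducing a form on $\mathfrak h^*$), $\alpha_1,\dots,\alpha_R\in\mathfrak h^*$ linearly independent, $H_i\in\mathfrak h$ given by $\lambda(H_i)=(\alpha_i,\lambda)$. $\mathfrak g$ is generated by $\mathfrak h$ and $E_i,F_i$ ($1\le i\le R$) with relations $[E_i,F_j]=\delta_{ij}H_i$, $[H,E_i]=\alpha_i(H)E_i$, $[H,F_i]=-\alpha_i(H)F_i$, $[H,H']=0$. $\mathfrak n,\mathfrak n_+$ are the free subalgebras generated by the $F_i$, resp. $E_i$; $\mathfrak g=\mathfrak n\oplus\mathfrak h\oplus\mathfrak n_+$. $\varphi$ is the anti-automorphism $E_i\leftrightarrow F_i$, $H\mapsto H$. $K$ is the $\mathfrak g$-invariant symmetric bilinear form on $\mathfrak g$ with $K=(\cdot,\cdot)$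 on $\mathfrak h$, $K(E_i,F_j)=\delta_{ij}$, zero on $\mathfrak n\times\mathfrak n$ and $\mathfrak n_+\times\mathfrak n_+$, $\mathfrak h\perp\mathfrak n\oplus\mathfrak n_+$; $S_{\mathfrak g}(x,y)=K(\varphi(x),y)$. $\sigma$ is an automorphism of $\mathfrak g$ of finite order $T$, with $\sigma(\mathfrak h)=\mathfrak h$, preserving $(\cdot,\cdot)$ on $\mathfrak h$, and $\sigma(E_i)=E_{\sigma(i)}$, $\sigma(F_i)=F_{\sigma(i)}$, $\sigma(H_i)=H_{\sigma(i)}$ for a permutation $\sigma\in\Sigma_R$. $\omega$ is a primitive $T$-th root of unity, $\mathbb Z_T=\mathbb Z/T\mathbb Z$. $r$ is the number of cycles of the permutation, $\iota(i)$ a chosen element of the $i$-th cycle, $T_i$ its length. $\mathfrak n$ is $\mathbb Z^r_{\ge0}$-graded with $\sigma^kF_{\iota(i)}$ of degree $e_i$, $\mathfrak n_+$ likewise with $\sigma^kE_{\iota(i)}$. For a non-zero $\lambda\in\mathbb Z^r_{\ge0}$ put $m=\lambda_1+\dots+\lambda_r$, $i_n:=\lambda_1+\dots+\lambda_{i-1}+n$ ($1\le n\le\lambda_i$), $w_\lambda=\prod_{i=1}^r(T/T_i)^{\lambda_i}\lambda_i!$. Free Lie algebra. $\mathfrak a$ is free on $f^{(k)}_i$, $1\le i\le m$, $k\in\mathbb Z_T$; $\tau(f_i^{(k)})=f_i^{(k+1)}$; $\bar{\mathfrak a}=\mathfrak a^\tau$; $\bar g=\sum_{j\in\mathbb Z_T}\tau^jg$;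 $f_i=f_i^{(0)}$; $\mathbb Z^m_{\ge0}$-grading with $f^{(k)}_i$ of degree $e_i$; $[1^m]$ is degree $(1,\dots,1)$. The homomorphism $\jmath:\mathfrak n\to\mathfrak a$, $\jmath(\sigma^kF_{\iota(i)})=\sum_{l=0}^{T/T_i-1}\sum_{n=1}^{\lambda_i}f^{(k+T_il)}_{i_n}$ ($0\le k<T_i$), satisfies $\jmath\sigma=\tau\jmath$; $s:\mathfrak n^\sigma_\lambda\to\bar{\mathfrak a}_{[1^m]}$ is $\jmath$ followed by projection to degree $[1^m]$. Arrangement $\mathcal C_{0;m}$ in $\mathbb C^m$: hyperplanes $t_i=\omega^kt_j$ ($i<j$, $k\in\mathbb Z_T$) and $t_i=0$, with weights $a(t_{i_n}=\omega^kt_{i'_{n'}})=(\alpha_{\iota(i)},\alpha_{\sigma^k(\iota(i'))})$ and $a(t_i=0)=0$. Edges are non-empty intersections of hyperplanes ($\mathbb C^m$ included). $\mathcal F^p$ is the complex space generated by flags $\mathbb C^m=L^0\supset\dots\supset L^p$ of edges, $\operatorname{codim}L^j=j$, modulo: for each $0<i<p$ and each chain with the $i$-th edge missing, the sum of all completing flags is $0$. For a flag $F$ and hyperplanes $H_1,\dots,H_p$, $\langle F,H_1\wedge\dots\wedge H_p\rangle=(-1)^{|s|}$ if $L^i=H_{s(1)}\cap\dots\cap H_{s(i)}$ for all $i$ for some (unique) $s\in\Sigma_p$, else $0$; this is well defined on $\mathcal F^p$. $G^p(F,F')=\sum\langle F,H_1\wedge\dots\wedge H_p\rangle\langle F',H_1\wedge\dots\wedge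 H_p\rangle a(H_1)\cdots a(H_p)$ over unordered $p$-tuples. Maps $\psi_p:(\bigwedge^p\bar{\mathfrak a}\otimes U(\bar{\mathfrak a}))_{[1^m]}\to\mathcal F^{m-p}(\mathcal C_{0;m})$. A commutator is a generator or a bracket of two commutators. For a commutator $g$ with generators $f^{(k_1)}_{i_1},\dots,f^{(k_l)}_{i_l}$ let $L_g:\omega^{k_1}t_{i_1}=\dots=\omega^{k_l}t_{i_l}$ and $L_g^0:t_{i_1}=\dots=t_{i_l}=0$. The $\psi_p$ are the linear maps determined by $\psi_m(\bar f_1\wedge\dots\wedge\bar f_m\otimes1)=(L^0=\mathbb C^m)$ and: whenever $g_i$ are commutators, $x_0$ is a product of elements $\bar g$ ($g$ commutators) and $\psi_{p+1}(\bar g_{p+1}\wedge\dots\wedge\bar g_1\otimes x_0)=\pm(L^0\supset\dots\supset L^q)$, $q=m-p-1$, then with the same sign $\psi_p(\bar g_{p+1}\wedge\dots\wedge\bar g_2\otimes\bar g_1x_0)=\pm(\dots\supset L^q\supset L^q\cap L^0_{g_1})$ and $\psi_p(\bar g_{p+1}\wedge\dots\wedge\bar g_3\wedge\overline{[g_1,g_2]}\otimes x_0)=\pm(\dots\supset L^q\supset L^q\cap L_{[g_1,g_2]})$. The form $\Omega$. $\Omega$ is the skew-symmetric bilinear form on $\mathfrak g^\sigma$ with $\Omega(\varphi(x),y)=-\Omega(y,\varphi(x))=\frac{(-1)^m}{w_\lambda}\,G^m\big(\psi_0(s(x)),\psi_0(s(y))\big)$ for $x,y\in\mathfrak n^\sigma_\lambda$,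 $\lambda\ne0$ (where $s(x),s(y)\in\bar{\mathfrak a}_{[1^m]}\subset U(\bar{\mathfrak a})_{[1^m]}$), and $\Omega=0$ on all other pairs of components of the decomposition $\mathfrak g^\sigma=\bigoplus_\lambda\mathfrak n^\sigma_\lambda\oplus\mathfrak h^\sigma\oplus\bigoplus_\lambda(\mathfrak n^\sigma_+)_\lambda$. $\Omega$ is a 2-cocycle and vanishes when one argument is in $\ker S_{\mathfrak g}\cap\mathfrak g^\sigma$; since $\tilde{\mathfrak g}^\sigma\cong\mathfrak g^\sigma/(\ker S_{\mathfrak g}\cap\mathfrak g^\sigma)$ canonically, it descends to a cocycle on $\tilde{\mathfrak g}^\sigma$, still denoted $\Omega$. *)

theory Defs
  imports Complex_Main "HOL-Library.Poly_Mapping" "HOL-Combinatorics.Orbits"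
begin

section \<open>Complex vector spaces and Lie algebras\<close>

class complex_vector = ab_group_add +
  fixes scaleC :: "complex \<Rightarrow> 'a \<Rightarrow> 'a"  (infixr \<open>*\<^sub>C\<close> 75)
  assumes scaleC_add_right: "a *\<^sub>C (x + y) = a *\<^sub>C x + a *\<^sub>C y"
    and scaleC_add_left: "(a + b) *\<^sub>C x = a *\<^sub>C x + b *\<^sub>C x"
    and scaleC_scaleC: "a *\<^sub>C b *\<^sub>C x = (a * b) *\<^sub>C x"
    and scaleC_one: "1 *\<^sub>C x = x"

global_interpretation cvec: vector_space "scaleC :: complex \<Rightarrow> 'a \<Rightarrow> 'a::complex_vector"
  by unfold_locales (simp_all add: scaleC_add_right scaleC_add_left scaleC_scaleC scaleC_one)

instantiation complex :: complex_vector
begin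
definition scaleC_complex :: "complex \<Rightarrow> complex \<Rightarrow> complex" where
  "scaleC_complex = (*)"
instance by standard (simp_all add: scaleC_complex_def algebra_simps)
end

instantiation poly_mapping :: (type, complex_vector) complex_vector
begin
definition scaleC_poly_mapping :: "complex \<Rightarrow> ('a \<Rightarrow>\<^sub>0 'b) \<Rightarrow> 'a \<Rightarrow>\<^sub>0 'b" where
  "scaleC_poly_mapping c f = Poly_Mapping.map (scaleC c) f"
lemma lookup_scaleC: "Poly_Mapping.lookup (c *\<^sub>C f) k = c *\<^sub>C Poly_Mapping.lookup f k"
  by (simp add: scaleC_poly_mapping_def map.rep_eq when_def)
instance
  by standard (auto intro!: poly_mapping_eqI
      simp: lookup_scaleC lookup_add scaleC_add_right scaleC_add_left scaleC_scaleC scaleC_one)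
end

class lie_algebra = complex_vector +
  fixes bracket :: "'a \<Rightarrow> 'a \<Rightarrow> 'a"  (\<open>\<^bold>[_,/ _\<^bold>]\<close>)
  assumes bracket_add_left: "\<^bold>[x + y, z\<^bold>] = \<^bold>[x, z\<^bold>] + \<^bold>[y, z\<^bold>]"
    and bracket_add_right: "\<^bold>[x, y + z\<^bold>] = \<^bold>[x, y\<^bold>] + \<^bold>[x, z\<^bold>]"
    and bracket_scaleC_left: "\<^bold>[a *\<^sub>C x, y\<^bold>] = a *\<^sub>C \<^bold>[x, y\<^bold>]"
    and bracket_scaleC_right: "\<^bold>[x, a *\<^sub>C y\<^bold>] = a *\<^sub>C \<^bold>[x, y\<^bold>]"
    and bracket_self: "\<^bold>[x, x\<^bold>] = 0"
    and jacobi_identity: "\<^bold>[x, \<^bold>[y, z\<^bold>]\<^bold>] + \<^bold>[y, \<^bold>[z, x\<^bold>]\<^bold>] + \<^bold>[z, \<^bold>[x, y\<^bold>]\<^bold>] = 0"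

definition clinear_on :: "'a::complex_vector set \<Rightarrow> ('a \<Rightarrow> 'b::complex_vector) \<Rightarrow> bool" where
  "clinear_on A f \<longleftrightarrow>
     (\<forall>x\<in>A. \<forall>y\<in>A. f (x + y) = f x + f y) \<and> (\<forall>c. \<forall>x\<in>A. f (c *\<^sub>C x) = c *\<^sub>C f x)"

abbreviation clinear :: "('a::complex_vector \<Rightarrow> 'b::complex_vector) \<Rightarrow> bool" where
  "clinear \<equiv> Vector_Spaces.linear scaleC scaleC"

definition cbilinear_on ::
  "'a::complex_vector set \<Rightarrow> ('a \<Rightarrow> 'a \<Rightarrow> complex) \<Rightarrow> bool" where
  "cbilinear_on A B \<longleftrightarrow>
     (\<forall>x\<in>A. clinear_on A (B x)) \<and> (\<forall>y\<in>A. clinear_on A (\<lambda>x. B x y))"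

definition lie_hom_on :: "'a::lie_algebra set \<Rightarrow> ('a \<Rightarrow> 'b::lie_algebra) \<Rightarrow> bool" where
  "lie_hom_on A f \<longleftrightarrow> clinear_on A f \<and> (\<forall>x\<in>A. \<forall>y\<in>A. f \<^bold>[x, y\<^bold>] = \<^bold>[f x, f y\<^bold>])"

definition lie_subalgebra :: "'a::lie_algebra set \<Rightarrow> bool" where
  "lie_subalgebra A \<longleftrightarrow> cvec.subspace A \<and> (\<forall>x\<in>A. \<forall>y\<in>A. \<^bold>[x, y\<^bold>] \<in> A)"

definition lie_ideal :: "'a::lie_algebra set \<Rightarrow> 'a set \<Rightarrow> bool" where
  "lie_ideal A I \<longleftrightarrow> cvec.subspace I \<and> I \<subseteq> A \<and> (\<forall>x\<in>A. \<forall>y\<in>I. \<^bold>[x, y\<^bold>] \<in> I)"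

definition fixed_points :: "('a \<Rightarrow> 'a) \<Rightarrow> 'a set" where
  "fixed_points f = {x. f x = x}"

text \<open>
  \<open>commutator gen X js x\<close>: the element \<open>x\<close> is a commutator in the generators \<open>gen j\<close>, \<open>j \<in> X\<close>,
  and \<open>js\<close> lists the indices of the generators that occur in it, with repetitions.
\<close>
inductive commutator ::
  "('j \<Rightarrow> 'a::lie_algebra) \<Rightarrow> 'j set \<Rightarrow> 'j list \<Rightarrow> 'a \<Rightarrow> bool"
  for gen :: "'j \<Rightarrow> 'a" and X :: "'j set" where
  single: "j \<in> X \<Longrightarrow> commutator gen X [j] (gen j)"
| bracket: "commutator gen X js x \<Longrightarrow> commutator gen X ks y \<Longrightarrow>
    commutator gen X (js @ ks) \<^bold>[x, y\<^bold>]"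

text \<open>
  The homogeneous component of multidegree \<open>d\<close> of the subalgebra generated by the \<open>gen j\<close>,
  \<open>j \<in> X\<close>, when \<open>gen j\<close> is given the degree \<open>e\<^bsub>deg j\<^esub>\<close>.
\<close>
definition homogeneous ::
  "('j \<Rightarrow> 'a::lie_algebra) \<Rightarrow> 'j set \<Rightarrow> ('j \<Rightarrow> nat) \<Rightarrow> (nat \<Rightarrow> nat) \<Rightarrow> 'a set" where
  "homogeneous gen X deg d =
     cvec.span {x. \<exists>js. commutator gen X js x \<and> count_list (map deg js) = d}"


section \<open>Free Lie algebras and presentations\<close>

datatype 'x lie_expr =
  EGen 'x | EZero | EAdd "'x lie_expr" "'x lie_expr" | EScale complex "'x lie_expr"
| EBr "'x lie_expr" "'x lie_expr"

text \<open>The least congruence on formal expressions that makes the quotient a Lie algebra.\<close>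
inductive lie_eq :: "'x lie_expr \<Rightarrow> 'x lie_expr \<Rightarrow> bool" where
  refl: "lie_eq s s"
| sym: "lie_eq s t \<Longrightarrow> lie_eq t s"
| trans: "lie_eq s t \<Longrightarrow> lie_eq t u \<Longrightarrow> lie_eq s u"
| cong_add: "lie_eq s s' \<Longrightarrow> lie_eq t t' \<Longrightarrow> lie_eq (EAdd s t) (EAdd s' t')"
| cong_scale: "lie_eq s s' \<Longrightarrow> lie_eq (EScale a s) (EScale a s')"
| cong_br: "lie_eq s s' \<Longrightarrow> lie_eq t t' \<Longrightarrow> lie_eq (EBr s t) (EBr s' t')"
| add_assoc: "lie_eq (EAdd (EAdd s t) u) (EAdd s (EAdd t u))"
| add_comm: "lie_eq (EAdd s t) (EAdd t s)"
| add_zero: "lie_eq (EAdd EZero s) s"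
| add_neg: "lie_eq (EAdd (EScale (- 1) s) s) EZero"
| scale_add_right: "lie_eq (EScale a (EAdd s t)) (EAdd (EScale a s) (EScale a t))"
| scale_add_left: "lie_eq (EScale (a + b) s) (EAdd (EScale a s) (EScale b s))"
| scale_scale: "lie_eq (EScale a (EScale b s)) (EScale (a * b) s)"
| scale_one: "lie_eq (EScale 1 s) s"
| br_add_left: "lie_eq (EBr (EAdd s t) u) (EAdd (EBr s u) (EBr t u))"
| br_add_right: "lie_eq (EBr s (EAdd t u)) (EAdd (EBr s t) (EBr s u))"
| br_scale_left: "lie_eq (EBr (EScale a s) t) (EScale a (EBr s t))"
| br_scale_right: "lie_eq (EBr s (EScale a t)) (EScale a (EBr s t))"
| br_self: "lie_eq (EBr s s) EZero"
| jacobi: "lie_eq (EAdd (EAdd (EBr s (EBr t u)) (EBr t (EBr u s))) (EBr u (EBr s t))) EZero"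

quotient_type 'x free_lie = "'x lie_expr" / lie_eq
  by (auto intro!: equivpI reflpI sympI transpI intro: lie_eq.refl lie_eq.sym lie_eq.trans)

instantiation free_lie :: (type) lie_algebra
begin
lift_definition zero_free_lie :: "'a free_lie" is EZero .
lift_definition plus_free_lie :: "'a free_lie \<Rightarrow> 'a free_lie \<Rightarrow> 'a free_lie" is EAdd
  by (rule lie_eq.cong_add)
lift_definition uminus_free_lie :: "'a free_lie \<Rightarrow> 'a free_lie" is "EScale (- 1)"
  by (rule lie_eq.cong_scale)
definition minus_free_lie :: "'a free_lie \<Rightarrow> 'a free_lie \<Rightarrow> 'a free_lie" where
  "minus_free_lie x y = x + - y"
lift_definition scaleC_free_lie :: "complex \<Rightarrow> 'a free_lie \<Rightarrow> 'a free_lie" is EScale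
  by (rule lie_eq.cong_scale)
lift_definition bracket_free_lie :: "'a free_lie \<Rightarrow> 'a free_lie \<Rightarrow> 'a free_lie" is EBr
  by (rule lie_eq.cong_br)
instance
proof
  fix x y z :: "'a free_lie" and a b :: complex
  show "x + y + z = x + (y + z)" by transfer (rule lie_eq.add_assoc)
  show "x + y = y + x" by transfer (rule lie_eq.add_comm)
  show "0 + x = x" by transfer (rule lie_eq.add_zero)
  show "- x + x = 0" by transfer (rule lie_eq.add_neg)
  show "x - y = x + - y" by (rule minus_free_lie_def)
  show "a *\<^sub>C (x + y) = a *\<^sub>C x + a *\<^sub>C y" by transfer (rule lie_eq.scale_add_right)
  show "(a + b) *\<^sub>C x = a *\<^sub>C x + b *\<^sub>C x" by transfer (rule lie_eq.scale_add_left)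
  show "a *\<^sub>C b *\<^sub>C x = (a * b) *\<^sub>C x" by transfer (rule lie_eq.scale_scale)
  show "1 *\<^sub>C x = x" by transfer (rule lie_eq.scale_one)
  show "\<^bold>[x + y, z\<^bold>] = \<^bold>[x, z\<^bold>] + \<^bold>[y, z\<^bold>]" by transfer (rule lie_eq.br_add_left)
  show "\<^bold>[x, y + z\<^bold>] = \<^bold>[x, y\<^bold>] + \<^bold>[x, z\<^bold>]" by transfer (rule lie_eq.br_add_right)
  show "\<^bold>[a *\<^sub>C x, y\<^bold>] = a *\<^sub>C \<^bold>[x, y\<^bold>]" by transfer (rule lie_eq.br_scale_left)
  show "\<^bold>[x, a *\<^sub>C y\<^bold>] = a *\<^sub>C \<^bold>[x, y\<^bold>]" by transfer (rule lie_eq.br_scale_right)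
  show "\<^bold>[x, x\<^bold>] = 0" by transfer (rule lie_eq.br_self)
  show "\<^bold>[x, \<^bold>[y, z\<^bold>]\<^bold>] + \<^bold>[y, \<^bold>[z, x\<^bold>]\<^bold>] + \<^bold>[z, \<^bold>[x, y\<^bold>]\<^bold>] = 0"
    by transfer (rule lie_eq.jacobi)
qed
end

lift_definition fgen :: "'x \<Rightarrow> 'x free_lie" is EGen .

primrec lie_eval :: "('x \<Rightarrow> 'a::lie_algebra) \<Rightarrow> 'x lie_expr \<Rightarrow> 'a" where
  "lie_eval g (EGen x) = g x"
| "lie_eval g EZero = 0"
| "lie_eval g (EAdd s t) = lie_eval g s + lie_eval g t"
| "lie_eval g (EScale a s) = a *\<^sub>C lie_eval g s"
| "lie_eval g (EBr s t) = \<^bold>[lie_eval g s, lie_eval g t\<^bold>]"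

lemma lie_eval_cong: "lie_eq s t \<Longrightarrow> lie_eval g s = lie_eval g t"
proof (induction rule: lie_eq.induct)
  case (jacobi s t u)
  show ?case by (simp add: jacobi_identity)
qed (simp_all add: add.assoc add.commute scaleC_add_right scaleC_add_left bracket_add_left
    bracket_add_right bracket_scaleC_left bracket_scaleC_right bracket_self)

text \<open>The homomorphism out of a free Lie algebra with prescribed values on the generators.\<close>
lift_definition fextend :: "('x \<Rightarrow> 'a::lie_algebra) \<Rightarrow> 'x free_lie \<Rightarrow> 'a" is lie_eval
  by (rule lie_eval_cong)

lemma fextend_fgen: "fextend g (fgen x) = g x"
  by transfer simp

lemma fextend_add: "fextend g (x + y) = fextend g x + fextend g y"
  by transfer (rule lie_eval.simps)

lemma fextend_scaleC: "fextend g (c *\<^sub>C x) = c *\<^sub>C fextend g x"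
  by transfer (rule lie_eval.simps)

lemma fextend_bracket: "fextend g \<^bold>[x, y\<^bold>] = \<^bold>[fextend g x, fextend g y\<^bold>]"
  by transfer (rule lie_eval.simps)

lemma fextend_lie_hom: "lie_hom_on UNIV (fextend g)"
  unfolding lie_hom_on_def clinear_on_def
  by (intro conjI ballI allI fextend_add fextend_scaleC fextend_bracket)

text \<open>The free Lie algebra on a subset \<open>X\<close> of the type of generators.\<close>
definition free_lie_on :: "'x set \<Rightarrow> 'x free_lie set" where
  "free_lie_on X = lie_subalgebra hull (fgen ` X)"

text \<open>
  The Lie algebra \<open>'a\<close> is generated by the elements \<open>g x\<close>, \<open>x \<in> X\<close>, with defining relators \<open>Rel\<close>:
  \<open>fextend g\<close> induces an isomorphism from the free Lie algebra on \<open>X\<close> modulo the ideal generated by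
  \<open>Rel\<close> onto \<open>'a\<close>.
\<close>
definition presented_by ::
  "'x set \<Rightarrow> 'x free_lie set \<Rightarrow> ('x \<Rightarrow> 'a::lie_algebra) \<Rightarrow> bool" where
  "presented_by X Rel g \<longleftrightarrow>
     fextend g ` free_lie_on X = UNIV \<and>
     {z \<in> free_lie_on X. fextend g z = 0} = lie_ideal (free_lie_on X) hull Rel"


section \<open>The Lie algebra attached to a Cartan datum, and diagram automorphisms\<close>

text \<open>
  The space \<open>h\<close> is the type \<open>'h\<close>, the Lie algebra is the type \<open>'g\<close>, and \<open>hincl\<close> is the map from
  \<open>h\<close> to it.  The simple roots and the generators are indexed by \<open>1, \<dots>, num_roots\<close>.
\<close>
record ('h, 'g) lie_data =
  hform :: "'h \<Rightarrow> 'h \<Rightarrow> complex"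
  num_roots :: nat
  simple_root :: "nat \<Rightarrow> 'h \<Rightarrow> complex"
  hincl :: "'h \<Rightarrow> 'g"
  gen_E :: "nat \<Rightarrow> 'g"
  gen_F :: "nat \<Rightarrow> 'g"

definition cartan_datum :: "('h::complex_vector, 'g, 'z) lie_data_scheme \<Rightarrow> bool" where
  "cartan_datum D \<longleftrightarrow>
     (\<exists>S. finite S \<and> cvec.span S = (UNIV :: 'h set)) \<and>
     cbilinear_on UNIV (hform D) \<and>
     (\<forall>x y. hform D x y = hform D y x) \<and>
     (\<forall>x. (\<forall>y. hform D x y = 0) \<longrightarrow> x = 0) \<and>
     (\<forall>i\<in>{1..num_roots D}. clinear (simple_root D i)) \<and>
     (\<forall>c. (\<forall>h. (\<Sum>i=1..num_roots D. c i * simple_root D i h) = 0) \<longrightarrow>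
        (\<forall>i\<in>{1..num_roots D}. c i = 0))"

text \<open>\<open>sharp D\<close> is the isomorphism from the dual of \<open>h\<close> to \<open>h\<close> given by the form on \<open>h\<close>.\<close>
definition sharp :: "('h, 'g, 'z) lie_data_scheme \<Rightarrow> ('h \<Rightarrow> complex) \<Rightarrow> 'h" where
  "sharp D l = (THE v. \<forall>h. hform D v h = l h)"

definition dual_form ::
  "('h, 'g, 'z) lie_data_scheme \<Rightarrow> ('h \<Rightarrow> complex) \<Rightarrow> ('h \<Rightarrow> complex) \<Rightarrow> complex" where
  "dual_form D l l' = hform D (sharp D l) (sharp D l')"

definition simple_H :: "('h::complex_vector, 'g, 'z) lie_data_scheme \<Rightarrow> nat \<Rightarrow> 'h" where
  "simple_H D i = (THE v. \<forall>l. clinear l \<longrightarrow> l v = dual_form D (simple_root D i) l)"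

datatype 'h lie_gen = GH 'h | GE nat | GF nat

definition lie_gens :: "('h, 'g, 'z) lie_data_scheme \<Rightarrow> 'h lie_gen set" where
  "lie_gens D = range GH \<union> GE ` {1..num_roots D} \<union> GF ` {1..num_roots D}"

text \<open>The first two sets make \<open>GH\<close> linear, i.e. all of the vector space \<open>h\<close> is put in as generators.\<close>
definition lie_relators ::
  "('h::complex_vector, 'g, 'z) lie_data_scheme \<Rightarrow> 'h lie_gen free_lie set" where
  "lie_relators D =
     (let I = {1..num_roots D}; H = (\<lambda>h. fgen (GH h)); E = (\<lambda>i. fgen (GE i)); F = (\<lambda>i. fgen (GF i)) in
      {H (h + h') - H h - H h' | h h'. True} \<union>
      {H (c *\<^sub>C h) - c *\<^sub>C H h | c h. True} \<union>
      {\<^bold>[E i, F j\<^bold>] - (if i = j then H (simple_H D i) else 0) | i j. i \<in> I \<and> j \<in> I} \<union>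
      {\<^bold>[H h, E i\<^bold>] - simple_root D i h *\<^sub>C E i | h i. i \<in> I} \<union>
      {\<^bold>[H h, F i\<^bold>] + simple_root D i h *\<^sub>C F i | h i. i \<in> I} \<union>
      {\<^bold>[H h, H h'\<^bold>] | h h'. True})"

definition attached_lie_algebra ::
  "('h::complex_vector, 'g::lie_algebra, 'z) lie_data_scheme \<Rightarrow> bool" where
  "attached_lie_algebra D \<longleftrightarrow>
     presented_by (lie_gens D) (lie_relators D) (case_lie_gen (hincl D) (gen_E D) (gen_F D))"

definition n_minus :: "('h, 'g::lie_algebra, 'z) lie_data_scheme \<Rightarrow> 'g set" where
  "n_minus D = lie_subalgebra hull (gen_F D ` {1..num_roots D})"

definition n_plus :: "('h, 'g::lie_algebra, 'z) lie_data_scheme \<Rightarrow> 'g set" where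
  "n_plus D = lie_subalgebra hull (gen_E D ` {1..num_roots D})"

definition transposition_antiaut ::
  "('h, 'g::lie_algebra, 'z) lie_data_scheme \<Rightarrow> ('g \<Rightarrow> 'g) \<Rightarrow> bool" where
  "transposition_antiaut D \<phi> \<longleftrightarrow>
     bij \<phi> \<and> clinear \<phi> \<and> (\<forall>x y. \<phi> \<^bold>[x, y\<^bold>] = \<^bold>[\<phi> y, \<phi> x\<^bold>]) \<and>
     (\<forall>i\<in>{1..num_roots D}. \<phi> (gen_E D i) = gen_F D i \<and> \<phi> (gen_F D i) = gen_E D i) \<and>
     (\<forall>h. \<phi> (hincl D h) = hincl D h)"

definition invariant_form ::
  "('h, 'g::lie_algebra, 'z) lie_data_scheme \<Rightarrow> ('g \<Rightarrow> 'g \<Rightarrow> complex) \<Rightarrow> bool" where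
  "invariant_form D K \<longleftrightarrow>
     cbilinear_on UNIV K \<and> (\<forall>x y. K x y = K y x) \<and>
     (\<forall>x y z. K \<^bold>[x, y\<^bold>] z = K x \<^bold>[y, z\<^bold>]) \<and>
     (\<forall>h h'. K (hincl D h) (hincl D h') = hform D h h') \<and>
     (\<forall>i\<in>{1..num_roots D}. \<forall>j\<in>{1..num_roots D}.
        K (gen_E D i) (gen_F D j) = (if i = j then 1 else 0)) \<and>
     (\<forall>x\<in>n_minus D. \<forall>y\<in>n_minus D. K x y = 0) \<and>
     (\<forall>x\<in>n_plus D. \<forall>y\<in>n_plus D. K x y = 0) \<and>
     (\<forall>h. \<forall>x\<in>n_minus D \<union> n_plus D. K (hincl D h) x = 0)"

definition form_kernel :: "('g \<Rightarrow> 'g) \<Rightarrow> ('g \<Rightarrow> 'g \<Rightarrow> complex) \<Rightarrow> 'g set" where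
  "form_kernel \<phi> K = {x. \<forall>y. K (\<phi> x) y = 0}"

text \<open>
  \<open>perm\<close> is the permutation of the indices, \<open>ordT\<close> is \<open>T\<close>, \<open>\<omega>\<close> is the root of unity and
  \<open>cyc_rep\<close> is the choice \<open>\<iota>\<close> of elements of the cycles.
\<close>
record ('h, 'g) diagram_data = "('h, 'g) lie_data" +
  aut :: "'g \<Rightarrow> 'g"
  perm :: "nat \<Rightarrow> nat"
  ordT :: nat
  omega :: complex
  cyc_rep :: "nat \<Rightarrow> nat"

definition diagram_automorphism ::
  "('h::complex_vector, 'g::lie_algebra, 'z) diagram_data_scheme \<Rightarrow> bool" where
  "diagram_automorphism D \<longleftrightarrow>
     bij (aut D) \<and> lie_hom_on UNIV (aut D) \<and>
     0 < ordT D \<and> aut D ^^ ordT D = id \<and> (\<forall>k. 0 < k \<and> k < ordT D \<longrightarrow> aut D ^^ k \<noteq> id) \<and>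
     aut D ` range (hincl D) = range (hincl D) \<and>
     (\<forall>h h' k k'. aut D (hincl D h) = hincl D k \<and> aut D (hincl D h') = hincl D k' \<longrightarrow>
        hform D k k' = hform D h h') \<and>
     perm D permutes {1..num_roots D} \<and>
     (\<forall>i\<in>{1..num_roots D}.
        aut D (gen_E D i) = gen_E D (perm D i) \<and>
        aut D (gen_F D i) = gen_F D (perm D i) \<and>
        aut D (hincl D (simple_H D i)) = hincl D (simple_H D (perm D i)))"

definition primitive_root_of_unity :: "nat \<Rightarrow> complex \<Rightarrow> bool" where
  "primitive_root_of_unity T w \<longleftrightarrow> w ^ T = 1 \<and> (\<forall>k. 0 < k \<and> k < T \<longrightarrow> w ^ k \<noteq> 1)"

definition num_cycles :: "('h, 'g, 'z) diagram_data_scheme \<Rightarrow> nat" where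
  "num_cycles D = card (orbit (perm D) ` {1..num_roots D})"

definition cycle_representatives :: "('h, 'g, 'z) diagram_data_scheme \<Rightarrow> bool" where
  "cycle_representatives D \<longleftrightarrow>
     cyc_rep D ` {1..num_cycles D} \<subseteq> {1..num_roots D} \<and>
     bij_betw (\<lambda>c. orbit (perm D) (cyc_rep D c)) {1..num_cycles D}
       (orbit (perm D) ` {1..num_roots D})"

definition cycle_length :: "('h, 'g, 'z) diagram_data_scheme \<Rightarrow> nat \<Rightarrow> nat" where
  "cycle_length D c = card (orbit (perm D) (cyc_rep D c))"

definition cycle_of :: "('h, 'g, 'z) diagram_data_scheme \<Rightarrow> nat \<Rightarrow> nat" where
  "cycle_of D j = (THE c. c \<in> {1..num_cycles D} \<and> j \<in> orbit (perm D) (cyc_rep D c))"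

definition n_minus_deg ::
  "('h, 'g::lie_algebra, 'z) diagram_data_scheme \<Rightarrow> (nat \<Rightarrow> nat) \<Rightarrow> 'g set" where
  "n_minus_deg D = homogeneous (gen_F D) {1..num_roots D} (cycle_of D)"

definition n_plus_deg ::
  "('h, 'g::lie_algebra, 'z) diagram_data_scheme \<Rightarrow> (nat \<Rightarrow> nat) \<Rightarrow> 'g set" where
  "n_plus_deg D = homogeneous (gen_E D) {1..num_roots D} (cycle_of D)"

text \<open>The non-zero elements of \<open>\<int>\<^sub>\<ge>\<^sub>0\<^sup>r\<close>, as functions supported in \<open>{1..r}\<close>.\<close>
definition nonzero_degrees :: "('h, 'g, 'z) diagram_data_scheme \<Rightarrow> (nat \<Rightarrow> nat) set" where
  "nonzero_degrees D = {lam. (\<forall>i. i \<notin> {1..num_cycles D} \<longrightarrow> lam i = 0) \<and> (\<exists>i. lam i \<noteq> 0)}"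

definition total :: "('h, 'g, 'z) diagram_data_scheme \<Rightarrow> (nat \<Rightarrow> nat) \<Rightarrow> nat" where
  "total D lam = (\<Sum>i=1..num_cycles D. lam i)"

text \<open>The index \<open>i\<^sub>n\<close>.\<close>
definition block_index :: "(nat \<Rightarrow> nat) \<Rightarrow> nat \<Rightarrow> nat \<Rightarrow> nat" where
  "block_index lam i n = (\<Sum>j=1..<i. lam j) + n"

text \<open>The \<open>i\<close> with \<open>u = i\<^sub>n\<close> for some \<open>1 \<le> n \<le> \<lambda>\<^sub>i\<close>.\<close>
definition block_of ::
  "('h, 'g, 'z) diagram_data_scheme \<Rightarrow> (nat \<Rightarrow> nat) \<Rightarrow> nat \<Rightarrow> nat" where
  "block_of D lam u =
     (THE i. i \<in> {1..num_cycles D} \<and> (\<exists>n\<in>{1..lam i}. u = block_index lam i n))"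

definition w_factor :: "('h, 'g, 'z) diagram_data_scheme \<Rightarrow> (nat \<Rightarrow> nat) \<Rightarrow> complex" where
  "w_factor D lam =
     (\<Prod>i=1..num_cycles D.
        (of_nat (ordT D) / of_nat (cycle_length D i)) ^ lam i * fact (lam i))"


section \<open>The free Lie algebra \<open>a\<close> on the \<open>f\<^sub>i\<^sup>(\<^sup>k\<^sup>)\<close>\<close>

text \<open>
  The generator \<open>f\<^sub>i\<^sup>(\<^sup>k\<^sup>)\<close> is \<open>fgen (i, k)\<close>, with \<open>k \<in> {..<T}\<close> representing an element of
  \<open>\<int>/T\<int>\<close>.
\<close>
definition a_gens :: "nat \<Rightarrow> nat \<Rightarrow> (nat \<times> nat) set" where
  "a_gens T m = {1..m} \<times> {..<T}"

definition a_alg :: "nat \<Rightarrow> nat \<Rightarrow> (nat \<times> nat) free_lie set" where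
  "a_alg T m = free_lie_on (a_gens T m)"

definition tau :: "nat \<Rightarrow> (nat \<times> nat) free_lie \<Rightarrow> (nat \<times> nat) free_lie" where
  "tau T = fextend (\<lambda>(i, k). fgen (i, (k + 1) mod T))"

definition abar :: "nat \<Rightarrow> nat \<Rightarrow> (nat \<times> nat) free_lie set" where
  "abar T m = a_alg T m \<inter> fixed_points (tau T)"

definition bar :: "nat \<Rightarrow> (nat \<times> nat) free_lie \<Rightarrow> (nat \<times> nat) free_lie" where
  "bar T g = (\<Sum>j<T. (tau T ^^ j) g)"

definition a_deg :: "nat \<Rightarrow> nat \<Rightarrow> (nat \<Rightarrow> nat) \<Rightarrow> (nat \<times> nat) free_lie set" where
  "a_deg T m = homogeneous fgen (a_gens T m) fst"

definition ones :: "nat \<Rightarrow> nat \<Rightarrow> nat" where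
  "ones m i = (if i \<in> {1..m} then 1 else 0)"

definition a_component ::
  "nat \<Rightarrow> nat \<Rightarrow> (nat \<Rightarrow> nat) \<Rightarrow> (nat \<times> nat) free_lie \<Rightarrow> (nat \<times> nat) free_lie" where
  "a_component T m d z =
     (THE z'. z' \<in> a_deg T m d \<and> z - z' \<in> cvec.span (\<Union>d'\<in>- {d}. a_deg T m d'))"

definition is_jmath ::
  "('h, 'g::lie_algebra, 'z) diagram_data_scheme \<Rightarrow> (nat \<Rightarrow> nat) \<Rightarrow>
     ('g \<Rightarrow> (nat \<times> nat) free_lie) \<Rightarrow> bool" where
  "is_jmath D lam J \<longleftrightarrow>
     lie_hom_on (n_minus D) J \<and>
     (\<forall>i\<in>{1..num_cycles D}. \<forall>k<cycle_length D i.
        J ((aut D ^^ k) (gen_F D (cyc_rep D i))) =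
          (\<Sum>l<ordT D div cycle_length D i. \<Sum>n=1..lam i.
             fgen (block_index lam i n, k + cycle_length D i * l)))"

definition s_map ::
  "('h, 'g, 'z) diagram_data_scheme \<Rightarrow> (nat \<Rightarrow> nat) \<Rightarrow>
     ('g \<Rightarrow> (nat \<times> nat) free_lie) \<Rightarrow> 'g \<Rightarrow> (nat \<times> nat) free_lie" where
  "s_map D lam J x = a_component (ordT D) (total D lam) (ones (total D lam)) (J x)"


section \<open>Exterior powers tensored with the enveloping algebra\<close>

text \<open>
  For a Lie subalgebra \<open>L\<close>, the space \<open>\<Lambda>\<^sup>p L \<otimes> U(L)\<close> is presented as the space of formal
  combinations of the symbols
  \<open>tens [g\<^sub>p, \<dots>, g\<^sub>1] [x\<^sub>1, \<dots>, x\<^sub>q] = g\<^sub>p \<and> \<dots> \<and> g\<^sub>1 \<otimes> x\<^sub>1 \<cdots> x\<^sub>q\<close>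
  with all entries in \<open>L\<close> and any \<open>q\<close>, modulo the span of \<open>tens_relators L p\<close>, i.e. as
  \<open>\<Lambda>\<^sup>p L \<otimes> T(L)\<close> modulo the ideal generated by the \<open>x y - y x - [x, y]\<close>.
\<close>
type_synonym 'a tens = "('a list \<times> 'a list) \<Rightarrow>\<^sub>0 complex"

definition tens :: "'a list \<Rightarrow> 'a list \<Rightarrow> 'a tens" where
  "tens gs xs = Poly_Mapping.single (gs, xs) 1"

definition tens_relators :: "'a::lie_algebra set \<Rightarrow> nat \<Rightarrow> 'a tens set" where
  "tens_relators L p =
     {tens (us @ (a *\<^sub>C x + b *\<^sub>C y) # vs) zs
        - a *\<^sub>C tens (us @ x # vs) zs - b *\<^sub>C tens (us @ y # vs) zs | us vs zs x y a b.
        length us + length vs + 1 = p \<and> set us \<union> set vs \<union> set zs \<union> {x, y} \<subseteq> L} \<union>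
     {tens (us @ x # vs @ x # ws) zs | us vs ws zs x.
        length us + length vs + length ws + 2 = p \<and>
        set us \<union> set vs \<union> set ws \<union> set zs \<union> {x} \<subseteq> L} \<union>
     {tens gs (us @ (a *\<^sub>C x + b *\<^sub>C y) # vs)
        - a *\<^sub>C tens gs (us @ x # vs) - b *\<^sub>C tens gs (us @ y # vs) | gs us vs x y a b.
        length gs = p \<and> set gs \<union> set us \<union> set vs \<union> {x, y} \<subseteq> L} \<union>
     {tens gs (us @ x # y # vs) - tens gs (us @ y # x # vs) - tens gs (us @ \<^bold>[x, y\<^bold>] # vs)
        | gs us vs x y.
        length gs = p \<and> set gs \<union> set us \<union> set vs \<union> {x, y} \<subseteq> L}"

text \<open>Representatives of the elements of \<open>\<Lambda>\<^sup>p abar \<otimes> U(abar)\<close> of multidegree \<open>[1\<^sup>m]\<close>.\<close>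
definition tens_ones :: "nat \<Rightarrow> nat \<Rightarrow> nat \<Rightarrow> (nat \<times> nat) free_lie tens set" where
  "tens_ones T m p =
     cvec.span {tens gs xs | gs xs.
       length gs = p \<and>
       (\<exists>ds. list_all2 (\<lambda>x d. x \<in> abar T m \<inter> a_deg T m d) (gs @ xs) ds \<and>
          (\<forall>i. (\<Sum>d\<leftarrow>ds. d i) = ones m i))}"


section \<open>The arrangement, its flags and the form \<open>G\<close>\<close>

text \<open>Points of \<open>\<complex>\<^sup>m\<close> are finitely supported families with support in \<open>{1..m}\<close>.\<close>
type_synonym point = "nat \<Rightarrow>\<^sub>0 complex"

definition Cspace :: "nat \<Rightarrow> point set" where
  "Cspace m = {t. Poly_Mapping.keys t \<subseteq> {1..m}}"

text \<open>
  Labels of the hyperplanes: \<open>Diag i j k\<close> is \<open>t\<^sub>i = \<omega>\<^sup>k t\<^sub>j\<close> and \<open>Coord i\<close> is \<open>t\<^sub>i = 0\<close>.  For a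
  primitive \<open>T\<close>-th root of unity \<open>\<omega>\<close>, distinct labels in \<open>arrangement T m\<close> denote distinct
  hyperplanes.
\<close>
datatype hyp = Diag nat nat nat | Coord nat

definition arrangement :: "nat \<Rightarrow> nat \<Rightarrow> hyp set" where
  "arrangement T m =
     {Diag i j k | i j k. 1 \<le> i \<and> i < j \<and> j \<le> m \<and> k < T} \<union> {Coord i | i. i \<in> {1..m}}"

fun hyperplane :: "complex \<Rightarrow> nat \<Rightarrow> hyp \<Rightarrow> point set" where
  "hyperplane w m (Diag i j k) =
     {t \<in> Cspace m. Poly_Mapping.lookup t i = w ^ k * Poly_Mapping.lookup t j}"
| "hyperplane w m (Coord i) = {t \<in> Cspace m. Poly_Mapping.lookup t i = 0}"

definition edges :: "nat \<Rightarrow> complex \<Rightarrow> nat \<Rightarrow> point set set" where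
  "edges T w m =
     {L. \<exists>S\<subseteq>arrangement T m. L = Cspace m \<inter> (\<Inter>H\<in>S. hyperplane w m H) \<and> L \<noteq> {}}"

definition codim :: "nat \<Rightarrow> point set \<Rightarrow> nat" where
  "codim m L = m - cvec.dim L"

text \<open>The flag \<open>L\<^sup>0 \<supset> \<dots> \<supset> L\<^sup>p\<close> is the list \<open>[L\<^sup>0, \<dots>, L\<^sup>p]\<close>.\<close>
definition flags :: "nat \<Rightarrow> complex \<Rightarrow> nat \<Rightarrow> nat \<Rightarrow> point set list set" where
  "flags T w m p =
     {F. length F = Suc p \<and> F ! 0 = Cspace m \<and> set F \<subseteq> edges T w m \<and>
         (\<forall>j<p. F ! Suc j \<subset> F ! j) \<and> (\<forall>j\<le>p. codim m (F ! j) = j)}"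

text \<open>
  Elements of \<open>\<F>\<^sup>p\<close> are represented by elements of \<open>flag_sums\<close>, and equality in \<open>\<F>\<^sup>p\<close> is \<open>flag_eq\<close>.
  In a relator, the list \<open>C\<close> is a chain in which the \<open>i\<close>-th edge is missing; lists which cannot be
  completed to a flag contribute the relator \<open>0\<close>.
\<close>
type_synonym flag_sum = "point set list \<Rightarrow>\<^sub>0 complex"

definition flag_sums :: "nat \<Rightarrow> complex \<Rightarrow> nat \<Rightarrow> nat \<Rightarrow> flag_sum set" where
  "flag_sums T w m p = cvec.span ((\<lambda>F. Poly_Mapping.single F 1) ` flags T w m p)"

definition flag_relators :: "nat \<Rightarrow> complex \<Rightarrow> nat \<Rightarrow> nat \<Rightarrow> flag_sum set" where
  "flag_relators T w m p =
     {\<Sum>F | F \<in> flags T w m p \<and> (\<exists>L. F = take i C @ L # drop i C). Poly_Mapping.single F 1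
        | i C. 0 < i \<and> i < p \<and> length C = p}"

definition flag_eq :: "nat \<Rightarrow> complex \<Rightarrow> nat \<Rightarrow> nat \<Rightarrow> flag_sum \<Rightarrow> flag_sum \<Rightarrow> bool" where
  "flag_eq T w m p u v \<longleftrightarrow> u - v \<in> cvec.span (flag_relators T w m p)"

text \<open>
  The pairing of a flag with \<open>H\<^sub>1 \<and> \<dots> \<and> H\<^sub>p\<close>, where \<open>Hs = [H\<^sub>1, \<dots>, H\<^sub>p]\<close>; the list positions, and
  hence the permutations, start at \<open>0\<close>.
\<close>
definition flag_adapted ::
  "complex \<Rightarrow> nat \<Rightarrow> point set list \<Rightarrow> hyp list \<Rightarrow> (nat \<Rightarrow> nat) \<Rightarrow> bool" where
  "flag_adapted w m F Hs s \<longleftrightarrow>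
     s permutes {..<length Hs} \<and> length F = Suc (length Hs) \<and>
     (\<forall>i\<le>length Hs. F ! i = Cspace m \<inter> (\<Inter>j<i. hyperplane w m (Hs ! s j)))"

definition flag_pairing :: "complex \<Rightarrow> nat \<Rightarrow> point set list \<Rightarrow> hyp list \<Rightarrow> complex" where
  "flag_pairing w m F Hs =
     (if \<exists>s. flag_adapted w m F Hs s then of_int (sign (THE s. flag_adapted w m F Hs s)) else 0)"

definition pairing :: "complex \<Rightarrow> nat \<Rightarrow> flag_sum \<Rightarrow> hyp list \<Rightarrow> complex" where
  "pairing w m u Hs =
     (\<Sum>F\<in>Poly_Mapping.keys u. Poly_Mapping.lookup u F * flag_pairing w m F Hs)"

text \<open>
  The summand does not depend on the chosen enumeration \<open>Hs\<close> of the unordered tuple \<open>S\<close>.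
\<close>
definition G_form ::
  "nat \<Rightarrow> complex \<Rightarrow> nat \<Rightarrow> (hyp \<Rightarrow> complex) \<Rightarrow> nat \<Rightarrow> flag_sum \<Rightarrow> flag_sum \<Rightarrow> complex" where
  "G_form T w m a p u v =
     (\<Sum>S | S \<subseteq> arrangement T m \<and> card S = p.
        let Hs = (SOME Hs. distinct Hs \<and> set Hs = S)
        in pairing w m u Hs * pairing w m v Hs * (\<Prod>H\<in>S. a H))"

fun weight ::
  "('h, 'g, 'z) diagram_data_scheme \<Rightarrow> (nat \<Rightarrow> nat) \<Rightarrow> hyp \<Rightarrow> complex" where
  "weight D lam (Diag u v k) =
     dual_form D (simple_root D (cyc_rep D (block_of D lam u)))
       (simple_root D ((perm D ^^ k) (cyc_rep D (block_of D lam v))))"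
| "weight D lam (Coord u) = 0"


section \<open>The maps \<open>\<psi>\<^sub>p\<close>\<close>

text \<open>Commutators are paired with the list of the generators occurring in them.\<close>
type_synonym comm = "(nat \<times> nat) list \<times> (nat \<times> nat) free_lie"

definition comms :: "nat \<Rightarrow> nat \<Rightarrow> comm set" where
  "comms T m = {(js, g). commutator fgen (a_gens T m) js g}"

definition comm_bracket :: "comm \<Rightarrow> comm \<Rightarrow> comm" where
  "comm_bracket c c' = (fst c @ fst c', \<^bold>[snd c, snd c'\<^bold>])"

definition bar_tens :: "nat \<Rightarrow> comm list \<Rightarrow> comm list \<Rightarrow> (nat \<times> nat) free_lie tens" where
  "bar_tens T cs ds = tens (map (bar T \<circ> snd) cs) (map (bar T \<circ> snd) ds)"

definition total_degree_ones :: "nat \<Rightarrow> comm list \<Rightarrow> bool" where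
  "total_degree_ones m cs \<longleftrightarrow> count_list (map fst (concat (map fst cs))) = ones m"

definition L_diag :: "complex \<Rightarrow> nat \<Rightarrow> comm \<Rightarrow> point set" where
  "L_diag w m c =
     {t \<in> Cspace m. \<forall>(i, k)\<in>set (fst c). \<forall>(i', k')\<in>set (fst c).
        w ^ k * Poly_Mapping.lookup t i = w ^ k' * Poly_Mapping.lookup t i'}"

definition L_zero :: "nat \<Rightarrow> comm \<Rightarrow> point set" where
  "L_zero m c = {t \<in> Cspace m. \<forall>(i, k)\<in>set (fst c). Poly_Mapping.lookup t i = 0}"

text \<open>
  \<open>P p\<close> represents the linear map \<open>\<psi>\<^sub>p\<close> from the degree \<open>[1\<^sup>m]\<close> part of \<open>\<Lambda>\<^sup>p abar \<otimes> U(abar)\<close> to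
  \<open>\<F>\<^sup>m\<^sup>-\<^sup>p\<close> on the representatives of the elements of both spaces: the first conjunct says that
  it descends to a well-defined linear map, the others are the conditions determining that map.
  The list \<open>gs\<close> is \<open>g\<^sub>p\<^sub>+\<^sub>1, \<dots>, g\<^sub>2\<close> in the third conjunct and \<open>g\<^sub>p\<^sub>+\<^sub>1, \<dots>, g\<^sub>3\<close> in the fourth,
  and \<open>xs\<close> lists the commutators whose bars are multiplied to \<open>x\<^sub>0\<close>.
\<close>
definition is_psi ::
  "nat \<Rightarrow> complex \<Rightarrow> nat \<Rightarrow> (nat \<Rightarrow> (nat \<times> nat) free_lie tens \<Rightarrow> flag_sum) \<Rightarrow> bool" where
  "is_psi T w m P \<longleftrightarrow>
     (\<forall>p\<le>m.
        (\<forall>z\<in>tens_ones T m p. P p z \<in> flag_sums T w m (m - p)) \<and>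
        (\<forall>z\<in>tens_ones T m p. \<forall>z'\<in>tens_ones T m p.
           flag_eq T w m (m - p) (P p (z + z')) (P p z + P p z')) \<and>
        (\<forall>c. \<forall>z\<in>tens_ones T m p. flag_eq T w m (m - p) (P p (c *\<^sub>C z)) (c *\<^sub>C P p z)) \<and>
        (\<forall>z\<in>tens_ones T m p \<inter> cvec.span (tens_relators (abar T m) p).
           flag_eq T w m (m - p) (P p z) 0)) \<and>
     flag_eq T w m 0 (P m (tens (map (\<lambda>i. bar T (fgen (i, 0))) [1..<Suc m]) []))
       (Poly_Mapping.single [Cspace m] 1) \<and>
     (\<forall>p gs g1 xs F. \<forall>e\<in>{1, - 1}.
        p < m \<and> length gs = p \<and> set (gs @ [g1] @ xs) \<subseteq> comms T m \<and>
        total_degree_ones m (gs @ [g1] @ xs) \<and> F \<in> flags T w m (m - p - 1) \<and>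
        flag_eq T w m (m - p - 1) (P (p + 1) (bar_tens T (gs @ [g1]) xs))
          (Poly_Mapping.single F e) \<longrightarrow>
        flag_eq T w m (m - p) (P p (bar_tens T gs (g1 # xs)))
          (Poly_Mapping.single (F @ [last F \<inter> L_zero m g1]) e)) \<and>
     (\<forall>p gs g1 g2 xs F. \<forall>e\<in>{1, - 1}.
        p < m \<and> length gs + 1 = p \<and> set (gs @ [g2, g1] @ xs) \<subseteq> comms T m \<and>
        total_degree_ones m (gs @ [g2, g1] @ xs) \<and> F \<in> flags T w m (m - p - 1) \<and>
        flag_eq T w m (m - p - 1) (P (p + 1) (bar_tens T (gs @ [g2, g1]) xs))
          (Poly_Mapping.single F e) \<longrightarrow>
        flag_eq T w m (m - p) (P p (bar_tens T (gs @ [comm_bracket g1 g2]) xs))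
          (Poly_Mapping.single (F @ [last F \<inter> L_diag w m (comm_bracket g1 g2)]) e))"


section \<open>The form \<open>\<Omega>\<close>\<close>

datatype component = Minus "nat \<Rightarrow> nat" | Zero | Plus "nat \<Rightarrow> nat"

definition components :: "('h, 'g, 'z) diagram_data_scheme \<Rightarrow> component set" where
  "components D = {Zero} \<union> Minus ` nonzero_degrees D \<union> Plus ` nonzero_degrees D"

fun fixed_component ::
  "('h, 'g::lie_algebra, 'z) diagram_data_scheme \<Rightarrow> component \<Rightarrow> 'g set" where
  "fixed_component D (Minus lam) = n_minus_deg D lam \<inter> fixed_points (aut D)"
| "fixed_component D Zero = range (hincl D) \<inter> fixed_points (aut D)"
| "fixed_component D (Plus lam) = n_plus_deg D lam \<inter> fixed_points (aut D)"

definition is_Omega ::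
  "('h, 'g::lie_algebra, 'z) diagram_data_scheme \<Rightarrow> ('g \<Rightarrow> 'g) \<Rightarrow>
     ((nat \<Rightarrow> nat) \<Rightarrow> 'g \<Rightarrow> (nat \<times> nat) free_lie) \<Rightarrow>
     (nat \<Rightarrow> nat \<Rightarrow> (nat \<times> nat) free_lie tens \<Rightarrow> flag_sum) \<Rightarrow> ('g \<Rightarrow> 'g \<Rightarrow> complex) \<Rightarrow> bool" where
  "is_Omega D \<phi> J \<psi> \<Omega> \<longleftrightarrow>
     cbilinear_on (fixed_points (aut D)) \<Omega> \<and>
     (\<forall>x\<in>fixed_points (aut D). \<forall>y\<in>fixed_points (aut D). \<Omega> x y = - \<Omega> y x) \<and>
     (\<forall>lam\<in>nonzero_degrees D.
        \<forall>x\<in>fixed_component D (Minus lam). \<forall>y\<in>fixed_component D (Minus lam).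
          let m = total D lam in
          \<Omega> (\<phi> x) y = (- 1) ^ m / w_factor D lam *
            G_form (ordT D) (omega D) m (weight D lam) m
              (\<psi> m 0 (tens [] [s_map D lam (J lam) x]))
              (\<psi> m 0 (tens [] [s_map D lam (J lam) y]))) \<and>
     (\<forall>c\<in>components D. \<forall>c'\<in>components D.
        (\<nexists>lam. (c = Plus lam \<and> c' = Minus lam) \<or> (c = Minus lam \<and> c' = Plus lam)) \<longrightarrow>
        (\<forall>x\<in>fixed_component D c. \<forall>y\<in>fixed_component D c'. \<Omega> x y = 0))"


section \<open>Quotients\<close>

definition lie_quotient_map ::
  "('a::lie_algebra \<Rightarrow> 'b::lie_algebra) \<Rightarrow> 'a set \<Rightarrow> bool" where
  "lie_quotient_map q N \<longleftrightarrow> lie_hom_on UNIV q \<and> surj q \<and> {x. q x = 0} = N"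

definition coboundary_on :: "'a::lie_algebra set \<Rightarrow> ('a \<Rightarrow> 'a \<Rightarrow> complex) \<Rightarrow> bool" where
  "coboundary_on A \<Omega> \<longleftrightarrow>
     (\<exists>\<alpha>. clinear_on A \<alpha> \<and> (\<forall>x\<in>A. \<forall>y\<in>A. \<Omega> x y = \<alpha> \<^bold>[x, y\<^bold>]))"

end

theory Submission
  imports Defs
begin

text \<open>
  Since \<open>\<Omega>\<close> pairs the component of degree \<open>\<lambda>\<close> of \<open>n\<^sub>+\<close> only with that of degree \<open>\<lambda>\<close> of \<open>n\<close>, a
  primitive \<open>\<alpha>\<close> of \<open>\<Omega>\<close> matters only on the brackets of these components.  Such a bracket lies in
  the span of the \<open>H\<^sub>i\<close> and is fixed by \<open>\<sigma>\<close>, hence lies in the span of the orbit sums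
  \<open>\<Sum>\<^sub>k \<sigma>\<^sup>k H\<^sub>i\<close>.  Up to a positive integer factor, an orbit sum is the bracket of the orbit sums of
  \<open>E\<^sub>i\<close> and \<open>F\<^sub>i\<close>, which are paired by \<open>\<Omega>\<close> through the form \<open>G\<^sup>1\<close> of the arrangement
  \<open>{t\<^sub>1 = 0}\<close> of weight \<open>0\<close>.  So \<open>\<alpha>\<close> vanishes on all orbit sums.
\<close>

subsection \<open>Lie algebras and linear maps\<close>

lemma clinearI:
  assumes "\<And>x y. f (x + y) = f x + f y" and "\<And>c x. f (c *\<^sub>C x) = c *\<^sub>C f x"
  shows "clinear f"
  using assms by unfold_locales

lemma clinear_on_UNIV_iff: "clinear_on UNIV f \<longleftrightarrow> clinear f"
  by (auto simp: clinear_on_def intro!: clinearI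
      dest: linear.axioms module_hom.add module_hom.scale Vector_Spaces.linear_iff[THEN iffD1])

lemma clinear_add: "clinear f \<Longrightarrow> f (x + y) = f x + f y"
  and clinear_scale: "clinear f \<Longrightarrow> f (c *\<^sub>C x) = c *\<^sub>C f x"
  by (auto simp: Vector_Spaces.linear_iff)

lemma clinear_zero: "clinear f \<Longrightarrow> f 0 = 0"
  using clinear_scale[of f 0 0] by simp

lemma clinear_diff: "clinear f \<Longrightarrow> f (x - y) = f x - f y"
  using clinear_add[of f "x - y" y] by (simp add: algebra_simps)

lemma clinear_sum: "clinear f \<Longrightarrow> f (\<Sum>x\<in>A. g x) = (\<Sum>x\<in>A. f (g x))"
  by (induction A rule: infinite_finite_induct) (auto simp: clinear_zero clinear_add)

lemma clinear_span_subset: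
  assumes "clinear f" "x \<in> cvec.span A" "cvec.subspace V" "\<And>a. a \<in> A \<Longrightarrow> f a \<in> V"
  shows "f x \<in> V"
proof -
  have "cvec.subspace {x. f x \<in> V}"
    using assms(1,3)
    by (auto intro!: cvec.subspaceI simp: clinear_add clinear_scale clinear_zero
        cvec.subspace_0 cvec.subspace_add cvec.subspace_scale)
  then show ?thesis
    using assms(2,4) cvec.span_minimal[of A "{x. f x \<in> V}"] by blast
qed

lemma clinear_on_span_zero:
  assumes "clinear_on V f" "cvec.subspace V" "A \<subseteq> V" "x \<in> cvec.span A"
    and "\<And>a. a \<in> A \<Longrightarrow> f a = 0"
  shows "f x = 0"
proof -
  \<comment> \<open>Linearity is known only on \<open>V\<close>, so \<open>f 0 = 0\<close> is read
    off from homogeneity at the point 0 of \<open>V\<close> with scalar 0.\<close>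
  have "f (0 *\<^sub>C 0) = 0 *\<^sub>C f 0"
    using assms(1) cvec.subspace_0[OF assms(2)] unfolding clinear_on_def by blast
  then have "cvec.subspace {x \<in> V. f x = 0}"
    using assms(1,2) by (auto intro!: cvec.subspaceI simp: clinear_on_def cvec.subspace_0
        cvec.subspace_add cvec.subspace_scale)
  then have "cvec.span A \<subseteq> {x \<in> V. f x = 0}"
    using assms(3,5) by (intro cvec.span_minimal) auto
  then show ?thesis
    using assms(4) by blast
qed

lemma clinear_funpow: "clinear f \<Longrightarrow> clinear (f ^^ k)" for f :: "'a::complex_vector \<Rightarrow> 'a"
  by (rule clinearI; induction k) (simp_all add: clinear_add clinear_scale)

lemma clinear_bracket_right: "clinear (\<lambda>y. \<^bold>[x, y\<^bold>])"
  and clinear_bracket_left: "clinear (\<lambda>x. \<^bold>[x, y\<^bold>])"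
  by (auto intro!: clinearI simp: bracket_add_left bracket_add_right bracket_scaleC_left
      bracket_scaleC_right)

lemma bracket_antisym: "\<^bold>[y, x\<^bold>] = - \<^bold>[x, y\<^bold>]" for x y :: "'a::lie_algebra"
proof -
  have "0 = \<^bold>[x + y, x + y\<^bold>]"
    by (rule bracket_self[symmetric])
  also have "\<dots> = \<^bold>[x, y\<^bold>] + \<^bold>[y, x\<^bold>]"
    unfolding bracket_add_left bracket_add_right by (simp add: bracket_self)
  finally show ?thesis
    by (simp add: eq_neg_iff_add_eq_0 add.commute)
qed

lemma bracket_zero_left: "\<^bold>[0, x\<^bold>] = (0::'a::lie_algebra)"
  by (rule clinear_zero[OF clinear_bracket_left])

lemma bracket_minus_left: "\<^bold>[- x, y\<^bold>] = - \<^bold>[x, y\<^bold>]" for x y :: "'a::lie_algebra"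
  using bracket_scaleC_left[of "- 1" x y] by (simp add: cvec.scale_minus_left)

text \<open>The Jacobi identity in the form that ad x is a derivation, which is what the inductions
  over commutators use.\<close>

lemma bracket_derivation: "\<^bold>[x, \<^bold>[y, z\<^bold>]\<^bold>] = \<^bold>[\<^bold>[x, y\<^bold>], z\<^bold>] + \<^bold>[y, \<^bold>[x, z\<^bold>]\<^bold>]"
  for x y z :: "'a::lie_algebra"
proof -
  have "\<^bold>[x, \<^bold>[y, z\<^bold>]\<^bold>] + - \<^bold>[y, \<^bold>[x, z\<^bold>]\<^bold>] + - \<^bold>[\<^bold>[x, y\<^bold>], z\<^bold>] = 0"
    using jacobi_identity[of x y z] clinear_scale[OF clinear_bracket_right, of y "- 1" "\<^bold>[x, z\<^bold>]"]
    by (simp add: bracket_antisym[of z x] bracket_antisym[of z "\<^bold>[x, y\<^bold>]"]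
        cvec.scale_minus_left)
  then show ?thesis
    by (simp add: algebra_simps)
qed

lemma lie_hom_clinear: "lie_hom_on UNIV f \<Longrightarrow> clinear f"
  and lie_hom_bracket: "lie_hom_on UNIV f \<Longrightarrow> f \<^bold>[x, y\<^bold>] = \<^bold>[f x, f y\<^bold>]"
  by (auto simp: lie_hom_on_def clinear_on_UNIV_iff)

lemma subspace_fixed_points: "clinear f \<Longrightarrow> cvec.subspace (fixed_points f)"
  by (auto intro!: cvec.subspaceI simp: fixed_points_def clinear_add clinear_scale clinear_zero)

section \<open>Lie algebras given by generators and relators\<close>

lemma fextend_clinear: "clinear (fextend g)"
  by (auto intro!: clinearI simp: fextend_add fextend_scaleC)

lemma presented_by_relator:
  assumes "presented_by X Rel g" and "z \<in> Rel"
  shows "fextend g z = 0"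
proof -
  have "z \<in> lie_ideal (free_lie_on X) hull Rel"
    using assms(2) by (rule hull_inc)
  then show ?thesis
    using assms(1) by (auto simp: presented_by_def)
qed

text \<open>The elements of the free Lie algebra that evaluate into \<open>S\<close> form a
  subalgebra containing the generators, so they contain \<open>free_lie_on X\<close>, whose image is
  the whole algebra.\<close>

lemma presented_by_generates:
  assumes "presented_by X Rel g" and S: "lie_subalgebra S" and "g ` X \<subseteq> S"
  shows "S = UNIV"
proof -
  have "free_lie_on X \<subseteq> {z. fextend g z \<in> S}"
    unfolding free_lie_on_def
  proof (rule hull_minimal)
    show "fgen ` X \<subseteq> {z. fextend g z \<in> S}"
      using assms(3) by (auto simp: fextend_fgen)
    show "lie_subalgebra {z. fextend g z \<in> S}"
      using S by (auto simp: lie_subalgebra_def fextend_bracket fextend_add fextend_scaleC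
          clinear_zero[OF fextend_clinear] cvec.subspace_def)
  qed
  then have "fextend g ` free_lie_on X \<subseteq> S"
    by blast
  then show ?thesis
    using assms(1) by (simp add: presented_by_def top.extremum_unique)
qed

text \<open>Testing against generators suffices: by the derivation rule the normalizer
  \<open>?N\<close> of \<open>S\<close> is a subalgebra, hence everything once it contains the
  generators, and then \<open>S\<close> is itself a subalgebra containing them.\<close>

lemma presented_by_ideal:
  assumes "presented_by X Rel g" and S: "cvec.subspace S" "g ` X \<subseteq> S"
    and closed: "\<And>x z. x \<in> X \<Longrightarrow> z \<in> S \<Longrightarrow> \<^bold>[g x, z\<^bold>] \<in> S"
  shows "S = UNIV"
proof -
  let ?N = "{x. \<forall>z\<in>S. \<^bold>[x, z\<^bold>] \<in> S}"
  have "\<^bold>[\<^bold>[x, y\<^bold>], z\<^bold>] \<in> S" if "x \<in> ?N" "y \<in> ?N" "z \<in> S" for x y z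
  proof -
    have "\<^bold>[\<^bold>[x, y\<^bold>], z\<^bold>] = \<^bold>[x, \<^bold>[y, z\<^bold>]\<^bold>] - \<^bold>[y, \<^bold>[x, z\<^bold>]\<^bold>]"
      by (simp add: bracket_derivation[of x y z])
    then show ?thesis
      using that S(1) by (simp add: cvec.subspace_diff)
  qed
  moreover have "cvec.subspace ?N"
    using S(1) by (auto intro!: cvec.subspaceI simp: bracket_add_left bracket_scaleC_left
        bracket_zero_left cvec.subspace_0 cvec.subspace_add cvec.subspace_scale)
  ultimately have "lie_subalgebra ?N"
    by (auto simp: lie_subalgebra_def)
  then have "?N = UNIV"
    by (rule presented_by_generates[OF assms(1)]) (use closed in blast)
  then have "lie_subalgebra S"
    using S(1) by (auto simp: lie_subalgebra_def)
  then show ?thesis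
    by (rule presented_by_generates[OF assms(1) _ S(2)])
qed


subsection \<open>Commutators\<close>

lemma commutator_set: "commutator gen X js x \<Longrightarrow> set js \<subseteq> X"
  and commutator_nonempty: "commutator gen X js x \<Longrightarrow> js \<noteq> []"
  by (induction rule: commutator.induct) auto

text \<open>ad h is a derivation, so eigenvalues add under brackets.\<close>

lemma commutator_eigenvector:
  assumes "commutator gen X js x" and "\<And>j. j \<in> X \<Longrightarrow> \<exists>s. \<^bold>[h, gen j\<^bold>] = s *\<^sub>C gen j"
  shows "\<exists>s. \<^bold>[h, x\<^bold>] = s *\<^sub>C x"
  using assms(1)
proof (induction rule: commutator.induct)
  case (single j)
  then show ?case
    by (rule assms(2))
next
  case (bracket js x ks y)
  obtain s t where "\<^bold>[h, x\<^bold>] = s *\<^sub>C x" "\<^bold>[h, y\<^bold>] = t *\<^sub>C y"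
    using bracket.IH by blast
  then have "\<^bold>[h, \<^bold>[x, y\<^bold>]\<^bold>] = (s + t) *\<^sub>C \<^bold>[x, y\<^bold>]"
    by (simp add: bracket_derivation[of h x y] bracket_scaleC_left bracket_scaleC_right
        scaleC_add_left)
  then show ?case
    by (rule exI)
qed

lemma commutator_lie_hom:
  assumes "commutator gen X js x" and "lie_hom_on UNIV f"
    and "\<And>j. j \<in> X \<Longrightarrow> p j \<in> X \<and> f (gen j) = gen (p j)"
  shows "commutator gen X (map p js) (f x)"
  using assms(1)
proof (induction rule: commutator.induct)
  case (single j)
  then show ?case
    using assms(3)[of j] commutator.single[of "p j" X gen] by simp
next
  case (bracket js x ks y)
  then show ?case
    using commutator.bracket[of gen X "map p js" "f x" "map p ks" "f y"]
    by (simp add: lie_hom_bracket[OF assms(2)])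
qed

text \<open>
  \<open>part k\<close> is the degree \<open>k\<close> component of the derived algebra for the grading in which
  \<open>e i\<close> has degree \<open>1\<close> and \<open>f i\<close> has degree \<open>- 1\<close>.  The hypotheses are invariant under exchanging
  \<open>e\<close> and \<open>f\<close> and replacing \<open>c\<close> by \<open>- c\<close>.
\<close>
locale contragredient =
  fixes I :: "'j set" and e f c :: "'j \<Rightarrow> 'a::lie_algebra" and a b :: "'j \<Rightarrow> 'j \<Rightarrow> complex"
  assumes e_f: "i \<in> I \<Longrightarrow> j \<in> I \<Longrightarrow> \<^bold>[e i, f j\<^bold>] = (if i = j then c i else 0)"
    and c_e: "i \<in> I \<Longrightarrow> j \<in> I \<Longrightarrow> \<^bold>[c i, e j\<^bold>] = a i j *\<^sub>C e j"
    and c_f: "i \<in> I \<Longrightarrow> j \<in> I \<Longrightarrow> \<^bold>[c i, f j\<^bold>] = b i j *\<^sub>C f j"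
begin

definition part :: "int \<Rightarrow> 'a set" where
  "part k =
     (if k > 0 then cvec.span {x. \<exists>js. commutator e I js x \<and> int (length js) = k}
      else if k = 0 then cvec.span (c ` I)
      else cvec.span {x. \<exists>js. commutator f I js x \<and> int (length js) = - k})"

lemma subspace_part: "cvec.subspace (part k)"
  by (simp add: part_def)

lemma e_commutator_in_part: "commutator e I js x \<Longrightarrow> x \<in> part (int (length js))"
  using commutator_nonempty[of e I js x] by (auto simp: part_def intro!: cvec.span_base)

lemma f_commutator_in_part: "commutator f I js x \<Longrightarrow> x \<in> part (- int (length js))"
  using commutator_nonempty[of f I js x] by (auto simp: part_def intro!: cvec.span_base)

text \<open>For k \<le> 0 everything stays on the \<open>f\<close> side: in degree 0 a commutator in
  the \<open>f j\<close> is an eigenvector of every \<open>c i\<close>, and in negative degree a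
  bracket of two commutators is again a commutator.\<close>

lemma part_bracket_f_commutator:
  assumes "u \<in> part k" "k \<le> 0" "commutator f I js y"
  shows "\<^bold>[u, y\<^bold>] \<in> part (k - int (length js))"
proof (cases "k = 0")
  case True
  have "\<exists>s. \<^bold>[c i, y\<^bold>] = s *\<^sub>C y" if "i \<in> I" for i
    by (rule commutator_eigenvector[OF assms(3)]) (use that c_f in blast)
  then have "\<^bold>[c i, y\<^bold>] \<in> part (k - int (length js))" if "i \<in> I" for i
    using that True f_commutator_in_part[OF assms(3)] subspace_part
    by (metis cvec.subspace_scale diff_0)
  then show ?thesis
    using assms(1) True
    by (intro clinear_span_subset[OF clinear_bracket_left, of u "c ` I"] subspace_part)
      (auto simp: part_def[of 0])
next
  case False
  have "u \<in> cvec.span {x. \<exists>js. commutator f I js x \<and> int (length js) = - k}"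
    using assms(1,2) False by (simp add: part_def)
  then show ?thesis
  proof (rule clinear_span_subset[OF clinear_bracket_left _ subspace_part])
    fix x assume "x \<in> {x. \<exists>js. commutator f I js x \<and> int (length js) = - k}"
    then obtain ks where ks: "commutator f I ks x" "int (length ks) = - k"
      by blast
    have "- int (length (ks @ js)) = k - int (length js)"
      using ks(2) by simp
    then show "\<^bold>[x, y\<^bold>] \<in> part (k - int (length js))"
      using f_commutator_in_part[OF commutator.bracket[OF ks(1) assms(3)]] by simp
  qed
qed

text \<open>Induction with the derivation rule: \<open>e i\<close> meets one factor of a bracket at
  a time, down to [e i, f j], which lies in degree 0.\<close>

lemma e_bracket_f_commutator:
  assumes "commutator f I js y" "i \<in> I"
  shows "\<^bold>[e i, y\<^bold>] \<in> part (1 - int (length js))"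
  using assms(1)
proof (induction rule: commutator.induct)
  case (single j)
  then show ?case
    using assms(2) by (auto simp: part_def e_f cvec.span_base cvec.span_zero)
next
  case (bracket js x ks y)
  \<comment> \<open>The degree \<open>1 - int (length js)\<close> of [e i, x] is at most 0 because
    \<open>js\<close> is non-empty; this is what admits
    \<open>part_bracket_f_commutator\<close>.\<close>
  have "\<^bold>[\<^bold>[e i, x\<^bold>], y\<^bold>] \<in> part (1 - int (length js) - int (length ks))"
    using commutator_nonempty[OF bracket.hyps(1)]
    by (intro part_bracket_f_commutator[OF bracket.IH(1) _ bracket.hyps(2)]) (simp add: Suc_le_eq)
  moreover have "\<^bold>[\<^bold>[e i, y\<^bold>], x\<^bold>] \<in> part (1 - int (length ks) - int (length js))"
    using commutator_nonempty[OF bracket.hyps(2)]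
    by (intro part_bracket_f_commutator[OF bracket.IH(2) _ bracket.hyps(1)]) (simp add: Suc_le_eq)
  ultimately show ?case
    using subspace_part[of "1 - int (length (js @ ks))"]
    by (simp add: bracket_derivation[of "e i" x y] bracket_antisym[of x "\<^bold>[e i, y\<^bold>]"] algebra_simps
        cvec.subspace_diff)
qed

text \<open>The sign of k decides the reason: for k > 0 a longer commutator arises, for k = 0 the
  \<open>c j\<close> act on \<open>e i\<close> by scalars, and for k < 0 the preceding lemma
  applies.\<close>

lemma e_bracket_part:
  assumes "u \<in> part k" "i \<in> I"
  shows "\<^bold>[e i, u\<^bold>] \<in> part (k + 1)"
proof -
  have ei: "commutator e I [i] (e i)"
    using assms(2) by (rule commutator.single)
  consider "k > 0" | "k = 0" | "k < 0" by linarith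
  then show ?thesis
  proof cases
    case 1
    have "\<^bold>[e i, x\<^bold>] \<in> part (k + 1)" if "commutator e I js x" "int (length js) = k" for js x
      using e_commutator_in_part[OF commutator.bracket[OF ei that(1)]] that(2)
      by (simp add: add.commute)
    then show ?thesis
      using assms(1) 1
      by (intro clinear_span_subset[OF clinear_bracket_right, of u "{x. \<exists>js. commutator e I js x \<and> int (length js) = k}"] subspace_part)
        (auto simp: part_def[of k])
  next
    case 2
    have "\<^bold>[e i, c j\<^bold>] \<in> part 1" if "j \<in> I" for j
      using e_commutator_in_part[OF ei] that assms(2) subspace_part[of 1]
      by (simp add: bracket_antisym[of "e i"] c_e cvec.subspace_neg cvec.subspace_scale)
    then show ?thesis
      using assms(1) 2
      by (intro clinear_span_subset[OF clinear_bracket_right, of u "c ` I"] subspace_part)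
        (auto simp: part_def[of 0])
  next
    case 3
    have "\<^bold>[e i, x\<^bold>] \<in> part (k + 1)" if "commutator f I js x" "int (length js) = - k" for js x
      using e_bracket_f_commutator[OF that(1) assms(2)] that(2)
      by (simp add: add.commute)
    then show ?thesis
      using assms(1) 3
      by (intro clinear_span_subset[OF clinear_bracket_right, of u "{x. \<exists>js. commutator f I js x \<and> int (length js) = - k}"] subspace_part)
        (auto simp: part_def[of k])
  qed
qed

text \<open>ad [x, y] is the commutator of ad x and ad y, and degrees add. The induction passes
  through intermediate parts, hence the arbitrary \<open>k\<close> and \<open>u\<close>.\<close>

lemma e_commutator_bracket_part:
  assumes "commutator e I js x" "u \<in> part k"
  shows "\<^bold>[x, u\<^bold>] \<in> part (k + int (length js))"
  using assms
proof (induction arbitrary: k u rule: commutator.induct)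
  case (bracket js x ks y)
  have "\<^bold>[x, \<^bold>[y, u\<^bold>]\<^bold>] \<in> part (k + int (length (js @ ks)))"
    and "\<^bold>[y, \<^bold>[x, u\<^bold>]\<^bold>] \<in> part (k + int (length (js @ ks)))"
    using bracket.IH(1)[OF bracket.IH(2)[OF bracket.prems]]
      bracket.IH(2)[OF bracket.IH(1)[OF bracket.prems]]
    by (simp_all add: algebra_simps)
  moreover have "\<^bold>[\<^bold>[x, y\<^bold>], u\<^bold>] = \<^bold>[x, \<^bold>[y, u\<^bold>]\<^bold>] - \<^bold>[y, \<^bold>[x, u\<^bold>]\<^bold>]"
    by (simp add: bracket_derivation[of x y u])
  ultimately show ?case
    by (simp add: cvec.subspace_diff subspace_part)
qed (simp add: e_bracket_part)

text \<open>The degrees n and -n cancel, and \<open>part 0\<close> is the span of the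
  \<open>c i\<close>.\<close>

lemma bracket_opposite_degrees:
  assumes "x \<in> cvec.span {x. \<exists>js. commutator e I js x \<and> length js = n}"
    and "y \<in> cvec.span {y. \<exists>ks. commutator f I ks y \<and> length ks = n}"
  shows "\<^bold>[x, y\<^bold>] \<in> cvec.span (c ` I)"
proof (rule clinear_span_subset[OF clinear_bracket_left assms(1) cvec.subspace_span])
  fix x assume "x \<in> {x. \<exists>js. commutator e I js x \<and> length js = n}"
  then obtain js where js: "commutator e I js x" "length js = n"
    by blast
  show "\<^bold>[x, y\<^bold>] \<in> cvec.span (c ` I)"
  proof (rule clinear_span_subset[OF clinear_bracket_right assms(2) cvec.subspace_span])
    fix y assume "y \<in> {y. \<exists>ks. commutator f I ks y \<and> length ks = n}"
    then obtain ks where ks: "commutator f I ks y" "length ks = n"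
      by blast
    then show "\<^bold>[x, y\<^bold>] \<in> cvec.span (c ` I)"
      using e_commutator_bracket_part[OF js(1) f_commutator_in_part[OF ks(1)]] js(2)
      by (simp add: part_def)
  qed
qed

text \<open>The set \<open>h\<close> stands for a Cartan subalgebra. As it contains the
  \<open>c i\<close>, every \<open>part k\<close> lies in the span of \<open>?B\<close>. Exchanging
  \<open>e\<close> and \<open>f\<close> in the locale gives the same for the other family of
  generators.\<close>

lemma e_bracket_triangular:
  assumes h: "\<And>y. y \<in> h \<Longrightarrow> \<exists>s. \<^bold>[y, e i\<^bold>] = s *\<^sub>C e i" and "c ` I \<subseteq> h" "i \<in> I"
    and z: "z \<in> cvec.span (h \<union> {x. \<exists>js. commutator e I js x} \<union> {x. \<exists>js. commutator f I js x})"
      (is "z \<in> cvec.span ?B")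
  shows "\<^bold>[e i, z\<^bold>] \<in> cvec.span ?B"
proof -
  have part: "part k \<subseteq> cvec.span ?B" for k
    by (simp only: part_def split: if_split)
      (intro conjI impI cvec.span_mono; use assms(2) in blast)
  show ?thesis
  proof (rule clinear_span_subset[OF clinear_bracket_right z cvec.subspace_span])
    fix x assume "x \<in> ?B"
    then consider "x \<in> h" | js where "commutator e I js x" | js where "commutator f I js x"
      by blast
    then show "\<^bold>[e i, x\<^bold>] \<in> cvec.span ?B"
    proof cases
      case 1
      then obtain s where "\<^bold>[x, e i\<^bold>] = s *\<^sub>C e i"
        using h by blast
      moreover have "e i \<in> cvec.span ?B"
        using assms(3) by (intro cvec.span_base) (auto intro: commutator.single)
      ultimately show ?thesis
        by (simp add: bracket_antisym[of "e i" x] cvec.span_neg cvec.span_scale)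
    next
      case 2
      then show ?thesis
        using e_bracket_part[OF e_commutator_in_part assms(3)] part by blast
    next
      case 3
      then show ?thesis
        using e_bracket_part[OF f_commutator_in_part assms(3)] part by blast
    qed
  qed
qed

end


subsection \<open>Averaging over a finite cyclic group\<close>

lemma funpow_fixed: "f x = x \<Longrightarrow> (f ^^ k) x = x"
  by (induction k) auto

text \<open>If \<open>f ^^ T = id\<close>, this is T times the projection onto the fixed points. All
  T powers are summed whatever the orbit length of \<open>z\<close>, so members of a shorter orbit
  are counted repeatedly.\<close>

definition cycle_sum :: "('a \<Rightarrow> 'a) \<Rightarrow> nat \<Rightarrow> 'a \<Rightarrow> 'a::complex_vector" where
  "cycle_sum f T z = (\<Sum>k<T. (f ^^ k) z)"

lemma clinear_cycle_sum:
  assumes "clinear f"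
  shows "clinear (cycle_sum f T)"
  using clinear_funpow[OF assms]
  by (auto intro!: clinearI simp: cycle_sum_def clinear_add clinear_scale sum.distrib
      cvec.scale_sum_right)

text \<open>Applying \<open>f\<close> shifts the index by one: the new last term
  \<open>(f ^^ T) z = z\<close> replaces the lost first term \<open>z\<close>.\<close>

lemma cycle_sum_in_fixed_points:
  assumes "clinear f" and "f ^^ T = id"
  shows "cycle_sum f T z \<in> fixed_points f"
proof -
  have "f (cycle_sum f T z) + z = (\<Sum>k<T. (f ^^ Suc k) z) + z"
    by (simp add: cycle_sum_def clinear_sum[OF assms(1)])
  also have "\<dots> = (\<Sum>k<Suc T. (f ^^ k) z)"
    unfolding sum.lessThan_Suc_shift by simp
  also have "\<dots> = cycle_sum f T z + z"
    using assms(2) by (simp add: cycle_sum_def del: funpow.simps)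
  finally show ?thesis
    by (simp add: fixed_points_def)
qed

lemma cycle_sum_fixed: "x \<in> fixed_points f \<Longrightarrow> cycle_sum f T x = of_nat T *\<^sub>C x"
  by (simp add: cycle_sum_def fixed_points_def funpow_fixed cvec.sum_constant_scale)

text \<open>A fixed point is 1/T times its own cycle sum, and the linear operator
  \<open>cycle_sum f T\<close> carries the span of \<open>A\<close> into the span of the cycle
  sums.\<close>

lemma fixed_point_in_span_cycle_sum:
  assumes "clinear f" "0 < T" "x \<in> fixed_points f" "x \<in> cvec.span A"
  shows "x \<in> cvec.span (cycle_sum f T ` A)"
proof -
  have "cycle_sum f T x \<in> cvec.span (cycle_sum f T ` A)"
    by (rule clinear_span_subset[OF clinear_cycle_sum[OF assms(1)] assms(4) cvec.subspace_span])
      (simp add: cvec.span_base)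
  then have "(1 / of_nat T) *\<^sub>C of_nat T *\<^sub>C x \<in> cvec.span (cycle_sum f T ` A)"
    by (rule cvec.span_scale[OF back_subst[of "\<lambda>v. v \<in> _"]]) (rule cycle_sum_fixed[OF assms(3)])
  moreover have "(1 / of_nat T) *\<^sub>C of_nat T *\<^sub>C x = x"
    using assms(2) by simp
  ultimately show ?thesis
    by metis
qed


subsection \<open>The fixed-point subalgebra\<close>

locale diagram_lie_algebra =
  fixes D :: "('h::complex_vector, 'g::lie_algebra) diagram_data"
  assumes attached: "attached_lie_algebra D"
    and automorphism: "diagram_automorphism D"
    and representatives: "cycle_representatives D"
begin

abbreviation "I \<equiv> {1..num_roots D}"

abbreviation "H i \<equiv> hincl D (simple_H D i)"

section \<open>The defining relations and the triangular decomposition\<close>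

lemma relator: "z \<in> lie_relators D \<Longrightarrow>
    fextend (case_lie_gen (hincl D) (gen_E D) (gen_F D)) z = 0"
  using attached unfolding attached_lie_algebra_def by (rule presented_by_relator)

lemmas fextend_simps =
  fextend_fgen fextend_add fextend_scaleC fextend_bracket clinear_diff[OF fextend_clinear]
  clinear_zero[OF fextend_clinear]

lemma bracket_E_F:
  assumes "i \<in> I" "j \<in> I"
  shows "\<^bold>[gen_E D i, gen_F D j\<^bold>] = (if i = j then H i else 0)"
proof -
  have "\<^bold>[fgen (GE i), fgen (GF j)\<^bold>] - (if i = j then fgen (GH (simple_H D i)) else 0)
      \<in> lie_relators D"
    unfolding lie_relators_def Let_def using assms by blast
  from relator[OF this] show ?thesis
    by (auto simp: fextend_simps split: if_splits)
qed

lemma bracket_h_E: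
  assumes "i \<in> I"
  shows "\<^bold>[hincl D h, gen_E D i\<^bold>] = simple_root D i h *\<^sub>C gen_E D i"
proof -
  have "\<^bold>[fgen (GH h), fgen (GE i)\<^bold>] - simple_root D i h *\<^sub>C fgen (GE i) \<in> lie_relators D"
    unfolding lie_relators_def Let_def using assms by blast
  from relator[OF this] show ?thesis
    by (simp add: fextend_simps)
qed

lemma bracket_h_F:
  assumes "i \<in> I"
  shows "\<^bold>[hincl D h, gen_F D i\<^bold>] = - simple_root D i h *\<^sub>C gen_F D i"
proof -
  have "\<^bold>[fgen (GH h), fgen (GF i)\<^bold>] + simple_root D i h *\<^sub>C fgen (GF i) \<in> lie_relators D"
    unfolding lie_relators_def Let_def using assms by blast
  from relator[OF this] show ?thesis
    by (simp add: fextend_simps cvec.scale_minus_left eq_neg_iff_add_eq_0)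
qed

lemma bracket_h_h: "\<^bold>[hincl D h, hincl D h'\<^bold>] = 0"
proof -
  have "\<^bold>[fgen (GH h), fgen (GH h')\<^bold>] \<in> lie_relators D"
    unfolding lie_relators_def Let_def by blast
  from relator[OF this] show ?thesis
    by (simp add: fextend_simps)
qed

lemma clinear_hincl: "clinear (hincl D)"
proof (rule clinearI)
  fix h h' c
  have "fgen (GH (h + h')) - fgen (GH h) - fgen (GH h') \<in> lie_relators D"
    and "fgen (GH (c *\<^sub>C h)) - c *\<^sub>C fgen (GH h) \<in> lie_relators D"
    unfolding lie_relators_def Let_def by blast+
  from this[THEN relator] show "hincl D (h + h') = hincl D h + hincl D h'"
    "hincl D (c *\<^sub>C h) = c *\<^sub>C hincl D h"
    by (simp_all add: fextend_simps algebra_simps)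
qed

sublocale E_F: contragredient I "gen_E D" "gen_F D" H
  "\<lambda>i j. simple_root D j (simple_H D i)" "\<lambda>i j. - simple_root D j (simple_H D i)"
  by unfold_locales (simp_all add: bracket_E_F bracket_h_E bracket_h_F del: atLeastAtMost_iff)

text \<open>Since \<open>- H i\<close> acts on \<open>gen_F D j\<close> by the scalar by which
  \<open>H i\<close> acts on \<open>gen_E D j\<close>, exchanging the two families leaves both
  scalar matrices unchanged.\<close>

sublocale F_E: contragredient I "gen_F D" "gen_E D" "\<lambda>i. - H i"
  "\<lambda>i j. simple_root D j (simple_H D i)" "\<lambda>i j. - simple_root D j (simple_H D i)"
proof unfold_locales
  show "\<^bold>[gen_F D i, gen_E D j\<^bold>] = (if i = j then - H i else 0)" if "i \<in> I" "j \<in> I" for i j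
    using bracket_E_F[OF that(2,1)] by (auto simp: bracket_antisym[of "gen_F D i"])
qed (simp_all add: bracket_minus_left bracket_h_E bracket_h_F cvec.scale_minus_left
    del: atLeastAtMost_iff)

text \<open>The spanning half of the triangular decomposition. By \<open>presented_by_ideal\<close>
  the span need only be stable under the generators: the elements of h act diagonally on the listed
  vectors, and the E and F generators are handled by the two instances of
  \<open>contragredient\<close>.\<close>

lemma triangular_span:
  "cvec.span (range (hincl D) \<union> {x. \<exists>js. commutator (gen_E D) I js x} \<union>
     {x. \<exists>js. commutator (gen_F D) I js x}) = UNIV" (is "cvec.span ?B = UNIV")
proof (rule presented_by_ideal)
  show "presented_by (lie_gens D) (lie_relators D) (case_lie_gen (hincl D) (gen_E D) (gen_F D))"
    using attached by (simp add: attached_lie_algebra_def)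
  show "cvec.subspace (cvec.span ?B)"
    by simp
  have "hincl D h \<in> cvec.span ?B" for h
    by (rule cvec.span_base) blast
  moreover have "gen_E D i \<in> cvec.span ?B" "gen_F D i \<in> cvec.span ?B" if "i \<in> I" for i
    by (rule cvec.span_base, use commutator.single[OF that] in blast)+
  ultimately show "case_lie_gen (hincl D) (gen_E D) (gen_F D) ` lie_gens D \<subseteq> cvec.span ?B"
    by (auto simp: lie_gens_def)
  fix x z assume x: "x \<in> lie_gens D" and z: "z \<in> cvec.span ?B"
  have h: "\<^bold>[hincl D h, z\<^bold>] \<in> cvec.span ?B" for h
  proof (rule clinear_span_subset[OF clinear_bracket_right z cvec.subspace_span])
    fix b assume b: "b \<in> ?B"
    have "\<exists>s. \<^bold>[hincl D h, b\<^bold>] = s *\<^sub>C b"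
      using b
    proof (elim UnE CollectE exE)
      assume "b \<in> range (hincl D)"
      then show ?thesis
        by (auto simp: bracket_h_h intro!: exI[of _ 0])
    next
      fix js assume "commutator (gen_E D) I js b"
      then show ?thesis
        by (rule commutator_eigenvector) (use bracket_h_E in blast)
    next
      fix js assume "commutator (gen_F D) I js b"
      then show ?thesis
        by (rule commutator_eigenvector) (use bracket_h_F in blast)
    qed
    then show "\<^bold>[hincl D h, b\<^bold>] \<in> cvec.span ?B"
      using cvec.span_base[OF b] cvec.span_scale by metis
  qed
  have E: "\<^bold>[gen_E D i, z\<^bold>] \<in> cvec.span ?B" if "i \<in> I" for i
    by (rule E_F.e_bracket_triangular[OF _ _ that z]) (use that bracket_h_E in blast)+
  have F: "\<^bold>[gen_F D i, z\<^bold>] \<in> cvec.span ?B" if "i \<in> I" for i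
  proof -
    have B: "?B = range (hincl D) \<union> {x. \<exists>js. commutator (gen_F D) I js x} \<union>
        {x. \<exists>js. commutator (gen_E D) I js x}"
      by blast
    \<comment> \<open>In the instance \<open>F_E\<close> the degree-zero elements are the
      \<open>- H j\<close>; by linearity of \<open>hincl D\<close> they lie in the image of
      h.\<close>
    have "- H j \<in> range (hincl D)" for j
      using clinear_scale[OF clinear_hincl, of "- 1" "simple_H D j"]
      by (metis cvec.scale_minus_left rangeI scaleC_one)
    then have H: "(\<lambda>j. - H j) ` I \<subseteq> range (hincl D)"
      by blast
    have h_F: "\<exists>s. \<^bold>[y, gen_F D i\<^bold>] = s *\<^sub>C gen_F D i" if "y \<in> range (hincl D)" for y
      using bracket_h_F[OF \<open>i \<in> I\<close>] that by blast
    show ?thesis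
      unfolding B by (rule F_E.e_bracket_triangular[OF h_F H that]) (use z B in simp_all)
  qed
  show "\<^bold>[case_lie_gen (hincl D) (gen_E D) (gen_F D) x, z\<^bold>] \<in> cvec.span ?B"
    using x h E F by (auto simp: lie_gens_def)
qed

section \<open>The automorphism on generators, orbits and cycles\<close>

lemma lie_hom_aut: "lie_hom_on UNIV (aut D)"
  using automorphism by (simp add: diagram_automorphism_def)

lemmas clinear_aut = lie_hom_clinear[OF lie_hom_aut]

lemma aut_funpow_ordT: "aut D ^^ ordT D = id" and ordT_pos: "0 < ordT D"
  using automorphism by (simp_all add: diagram_automorphism_def)

lemma perm_permutes: "perm D permutes I"
  using automorphism by (simp add: diagram_automorphism_def)

lemma permutation_perm: "permutation (perm D)"
  using perm_permutes by (auto simp: permutation_permutes)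

lemma perm_funpow_in: "i \<in> I \<Longrightarrow> (perm D ^^ k) i \<in> I"
  by (induction k) (simp_all only: funpow.simps comp_apply permutes_in_image[OF perm_permutes] id_apply)

lemma aut_gen:
  assumes "i \<in> I"
  shows "aut D (gen_E D i) = gen_E D (perm D i)" "aut D (gen_F D i) = gen_F D (perm D i)"
  using automorphism assms by (simp_all add: diagram_automorphism_def)

lemma aut_funpow_gen:
  assumes "i \<in> I"
  shows "(aut D ^^ k) (gen_E D i) = gen_E D ((perm D ^^ k) i)"
    "(aut D ^^ k) (gen_F D i) = gen_F D ((perm D ^^ k) i)"
  by (induction k) (simp_all add: aut_gen[OF perm_funpow_in[OF assms]])

text \<open>A permutation moving finitely many points has orbits that contain their base point, so
  they are equivalence classes.\<close>

lemma orbit_eq_iff: "j \<in> orbit (perm D) i \<longleftrightarrow> orbit (perm D) j = orbit (perm D) i"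
proof
  assume j: "j \<in> orbit (perm D) i"
  then have "i \<in> orbit (perm D) j"
    by (rule orbit_swap[OF permutation_self_in_orbit[OF permutation_perm]])
  with j show "orbit (perm D) j = orbit (perm D) i"
    using orbit_trans[of _ "perm D" i j] orbit_trans[of _ "perm D" j i] by blast
qed (use permutation_self_in_orbit[OF permutation_perm] in blast)

text \<open>The description defining \<open>cycle_of\<close> depends on \<open>j\<close> only
  through its orbit. This makes multidegrees invariant under the automorphism.\<close>

lemma cycle_of_perm: "cycle_of D (perm D j) = cycle_of D j"
  by (simp add: cycle_of_def orbit_eq_iff permutation_orbit_step[OF permutation_perm])

text \<open>The representatives meet each orbit of an index in \<open>I\<close> exactly once, so the
  description has a unique solution.\<close>

lemma cycle_of_in:
  assumes "j \<in> I"
  shows "cycle_of D j \<in> {1..num_cycles D}"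
proof -
  have bij: "bij_betw (\<lambda>c. orbit (perm D) (cyc_rep D c)) {1..num_cycles D} (orbit (perm D) ` I)"
    using representatives by (simp add: cycle_representatives_def)
  have "orbit (perm D) j \<in> (\<lambda>c. orbit (perm D) (cyc_rep D c)) ` {1..num_cycles D}"
    unfolding bij_betw_imp_surj_on[OF bij] using assms by (rule imageI)
  then obtain c where c: "c \<in> {1..num_cycles D}" "orbit (perm D) j = orbit (perm D) (cyc_rep D c)"
    by (rule imageE)
  have "cycle_of D j = c"
    unfolding cycle_of_def
  proof (rule the_equality)
    fix c' assume c': "c' \<in> {1..num_cycles D} \<and> j \<in> orbit (perm D) (cyc_rep D c')"
    then have "orbit (perm D) (cyc_rep D c') = orbit (perm D) (cyc_rep D c)"
      using c(2) orbit_eq_iff by simp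
    then show "c' = c"
      using inj_onD[OF bij_betw_imp_inj_on[OF bij]] c(1) c' by blast
  qed (use c orbit_eq_iff in simp)
  then show ?thesis
    using c(1) by simp
qed

section \<open>Multidegrees and the components of the fixed-point algebra\<close>

lemma degree_nonzero:
  assumes "js \<noteq> []" "set js \<subseteq> I"
  shows "count_list (map (cycle_of D) js) \<in> nonzero_degrees D"
    and "total D (count_list (map (cycle_of D) js)) = length js"
proof -
  have range: "set (map (cycle_of D) js) \<subseteq> {1..num_cycles D}"
    using assms(2) cycle_of_in by auto
  have "cycle_of D (hd js) \<in> set (map (cycle_of D) js)"
    using assms(1) by simp
  then have "count_list (map (cycle_of D) js) (cycle_of D (hd js)) \<noteq> 0"
    unfolding count_list_0_iff by blast
  moreover have "count_list (map (cycle_of D) js) i = 0" if "i \<notin> {1..num_cycles D}" for i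
    using range that by (intro count_notin) blast
  ultimately show "count_list (map (cycle_of D) js) \<in> nonzero_degrees D"
    unfolding nonzero_degrees_def by blast
  show "total D (count_list (map (cycle_of D) js)) = length js"
    using sum_count_set[OF range] by (simp add: total_def)
qed

text \<open>Each application of \<open>aut D\<close> moves the indices by \<open>perm D\<close>,
  hence within their cycles; \<open>g\<close> stands for either family of generators.\<close>

lemma commutator_funpow_aut:
  assumes "commutator g I js z" and "\<And>j. j \<in> I \<Longrightarrow> aut D (g j) = g (perm D j)"
  shows "\<exists>ks. commutator g I ks ((aut D ^^ k) z) \<and> map (cycle_of D) ks = map (cycle_of D) js"
proof (induction k)
  case 0
  then show ?case
    using assms(1) by auto
next
  case (Suc k)
  then obtain ks where ks: "commutator g I ks ((aut D ^^ k) z)"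
    "map (cycle_of D) ks = map (cycle_of D) js"
    by blast
  have "commutator g I (map (perm D) ks) (aut D ((aut D ^^ k) z))"
    by (rule commutator_lie_hom[OF ks(1) lie_hom_aut])
      (use assms(2) permutes_in_image[OF perm_permutes] in blast)
  moreover have "map (cycle_of D) (map (perm D) ks) = map (cycle_of D) ks"
    by (simp add: cycle_of_perm)
  ultimately show ?case
    using ks(2) by auto
qed

lemma cycle_sum_commutator:
  assumes "commutator g I js z" and "\<And>j. j \<in> I \<Longrightarrow> aut D (g j) = g (perm D j)"
  shows "cycle_sum (aut D) (ordT D) z
    \<in> homogeneous g I (cycle_of D) (count_list (map (cycle_of D) js)) \<inter> fixed_points (aut D)"
proof
  show "cycle_sum (aut D) (ordT D) z \<in> fixed_points (aut D)"
    using clinear_aut aut_funpow_ordT by (rule cycle_sum_in_fixed_points)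
  have "(aut D ^^ k) z \<in> homogeneous g I (cycle_of D) (count_list (map (cycle_of D) js))" for k
    using commutator_funpow_aut[OF assms, of k]
    unfolding homogeneous_def by (auto intro!: cvec.span_base)
  then show "cycle_sum (aut D) (ordT D) z
      \<in> homogeneous g I (cycle_of D) (count_list (map (cycle_of D) js))"
    unfolding cycle_sum_def homogeneous_def by (intro cvec.span_sum)
qed

text \<open>Averaging the vectors of \<open>triangular_span\<close> yields a spanning set of the
  fixed points, and each average falls into a single component because the automorphism preserves h
  and multidegrees.\<close>

lemma fixed_points_span_components:
  assumes "x \<in> fixed_points (aut D)"
  shows "x \<in> cvec.span (\<Union>c\<in>components D. fixed_component D c)"
proof -
  have "\<exists>c\<in>components D. cycle_sum (aut D) (ordT D) b \<in> fixed_component D c"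
    if "b \<in> range (hincl D) \<union> {x. \<exists>js. commutator (gen_E D) I js x} \<union>
      {x. \<exists>js. commutator (gen_F D) I js x}" for b
    using that
  proof (elim UnE CollectE exE)
    assume b: "b \<in> range (hincl D)"
    have "(aut D ^^ k) b \<in> range (hincl D)" for k
    proof (induction k)
      case (Suc k)
      then show ?case
        using automorphism imageI[of _ "range (hincl D)" "aut D"]
        by (simp add: diagram_automorphism_def)
    qed (use b in simp)
    moreover have "cvec.subspace (range (hincl D))"
      by (auto intro!: cvec.subspaceI intro: range_eqI
          simp: clinear_add[OF clinear_hincl, symmetric] clinear_scale[OF clinear_hincl, symmetric]
            clinear_zero[OF clinear_hincl, symmetric])
    ultimately have "cycle_sum (aut D) (ordT D) b \<in> fixed_component D Zero"
      using cycle_sum_in_fixed_points[OF clinear_aut aut_funpow_ordT]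
      by (simp add: cycle_sum_def cvec.subspace_sum)
    then show ?thesis
      by (auto simp: components_def)
  next
    fix js assume js: "commutator (gen_E D) I js b"
    show ?thesis
      using cycle_sum_commutator[OF js aut_gen(1)]
        degree_nonzero(1)[OF commutator_nonempty[OF js] commutator_set[OF js]]
      by (intro bexI[of _ "Plus (count_list (map (cycle_of D) js))"])
        (simp_all add: components_def n_plus_deg_def)
  next
    fix js assume js: "commutator (gen_F D) I js b"
    show ?thesis
      using cycle_sum_commutator[OF js aut_gen(2)]
        degree_nonzero(1)[OF commutator_nonempty[OF js] commutator_set[OF js]]
      by (intro bexI[of _ "Minus (count_list (map (cycle_of D) js))"])
        (simp_all add: components_def n_minus_deg_def)
  qed
  then have "cycle_sum (aut D) (ordT D) `
      (range (hincl D) \<union> {x. \<exists>js. commutator (gen_E D) I js x} \<union>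
        {x. \<exists>js. commutator (gen_F D) I js x}) \<subseteq> (\<Union>c\<in>components D. fixed_component D c)"
    by blast
  moreover have "x \<in> cvec.span (range (hincl D) \<union> {x. \<exists>js. commutator (gen_E D) I js x} \<union>
      {x. \<exists>js. commutator (gen_F D) I js x})"
    using triangular_span by simp
  ultimately show ?thesis
    using fixed_point_in_span_cycle_sum[OF clinear_aut ordT_pos assms] cvec.span_mono by blast
qed

text \<open>Passes from the multidegree to the total degree, the grading in which
  \<open>E_F.bracket_opposite_degrees\<close> is stated.\<close>

lemma homogeneous_subset_length:
  "homogeneous g I (cycle_of D) lam
    \<subseteq> cvec.span {x. \<exists>js. commutator g I js x \<and> length js = total D lam}"
  unfolding homogeneous_def
proof (intro cvec.span_mono Collect_mono impI, elim exE conjE)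
  fix x js
  assume "commutator g I js x" and lam: "count_list (map (cycle_of D) js) = lam"
  moreover from this(1) have "total D lam = length js"
    unfolding lam[symmetric]
    by (intro degree_nonzero(2) commutator_nonempty[of g I js x] commutator_set[of g I js x])
  ultimately show "\<exists>js. commutator g I js x \<and> length js = total D lam"
    by auto
qed

lemma bracket_opposite_components:
  assumes "x \<in> fixed_component D (Plus lam)" "y \<in> fixed_component D (Minus lam)"
  shows "\<^bold>[x, y\<^bold>] \<in> cvec.span (cycle_sum (aut D) (ordT D) ` H ` I)"
proof (rule fixed_point_in_span_cycle_sum[OF clinear_aut ordT_pos])
  show "\<^bold>[x, y\<^bold>] \<in> fixed_points (aut D)"
    using assms by (simp add: fixed_points_def lie_hom_bracket[OF lie_hom_aut])
  show "\<^bold>[x, y\<^bold>] \<in> cvec.span (H ` I)"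
    using assms homogeneous_subset_length
    by (intro E_F.bracket_opposite_degrees[where n = "total D lam"])
      (auto simp: n_plus_deg_def n_minus_deg_def)
qed

text \<open>The factor is the number of k < T with \<open>(perm D ^^ k) i = i\<close>, the only
  terms with a non-zero bracket against \<open>gen_E D i\<close>. As the cycle sum of
  \<open>gen_F D i\<close> is fixed, the averaging in the first argument can be taken outside the
  bracket.\<close>

lemma bracket_cycle_sums:
  assumes "i \<in> I"
  obtains n :: nat where "0 < n"
    "\<^bold>[cycle_sum (aut D) (ordT D) (gen_E D i), cycle_sum (aut D) (ordT D) (gen_F D i)\<^bold>] =
      of_nat n *\<^sub>C cycle_sum (aut D) (ordT D) (H i)"
proof -
  let ?s = "cycle_sum (aut D) (ordT D)"
  let ?A = "{k \<in> {..<ordT D}. i = (perm D ^^ k) i}"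
  have funpow_bracket: "(aut D ^^ k) \<^bold>[x, y\<^bold>] = \<^bold>[(aut D ^^ k) x, (aut D ^^ k) y\<^bold>]" for k x y
    by (induction k) (simp_all add: lie_hom_bracket[OF lie_hom_aut])
  have "\<^bold>[gen_E D i, ?s (gen_F D i)\<^bold>] = (\<Sum>k<ordT D. if i = (perm D ^^ k) i then H i else 0)"
    by (simp add: cycle_sum_def clinear_sum[OF clinear_bracket_right] aut_funpow_gen[OF assms]
        bracket_E_F[OF assms perm_funpow_in[OF assms]])
  also have "\<dots> = (\<Sum>k\<in>?A. H i)"
    by (rule sum.inter_filter[symmetric]) simp
  also have "\<dots> = of_nat (card ?A) *\<^sub>C H i"
    by (rule cvec.sum_constant_scale)
  finally have E: "\<^bold>[gen_E D i, ?s (gen_F D i)\<^bold>] = of_nat (card ?A) *\<^sub>C H i" .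
  have F: "(aut D ^^ k) (?s (gen_F D i)) = ?s (gen_F D i)" for k
    using cycle_sum_in_fixed_points[OF clinear_aut aut_funpow_ordT]
    by (intro funpow_fixed) (simp add: fixed_points_def)
  have "\<^bold>[?s (gen_E D i), ?s (gen_F D i)\<^bold>] = ?s \<^bold>[gen_E D i, ?s (gen_F D i)\<^bold>]"
    unfolding cycle_sum_def[of _ _ "gen_E D i"] cycle_sum_def[of _ _ "\<^bold>[_, _\<^bold>]"]
    by (simp only: clinear_sum[OF clinear_bracket_left] funpow_bracket F)
  also have "\<dots> = of_nat (card ?A) *\<^sub>C ?s (H i)"
    unfolding E by (rule clinear_scale[OF clinear_cycle_sum[OF clinear_aut]])
  finally show ?thesis
    \<comment> \<open>The exponent 0 always belongs to \<open>?A\<close>, so the factor is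
      positive.\<close>
    using ordT_pos by (intro that[of "card ?A"]) (auto simp: card_gt_0_iff intro!: exI[of _ 0])
qed

end


subsection \<open>The cocycle\<close>

text \<open>In rank one the only hyperplane is \<open>t\<^sub>1 = 0\<close>, which has weight \<open>0\<close>.\<close>
lemma G_form_rank_one: "G_form T w 1 (weight D lam) 1 u v = 0"
proof -
  have "(\<Prod>h\<in>S. weight D lam h) = 0" if "S \<subseteq> arrangement T 1" "card S = 1" for S
  proof -
    have "arrangement T 1 = {Coord 1}"
      by (auto simp: arrangement_def)
    then have "S = {Coord 1}"
      using that by (metis card.empty subset_singletonD zero_neq_one)
    then show ?thesis
      by simp
  qed
  then show ?thesis
    by (auto simp: G_form_def Let_def intro!: sum.neutral)
qed

text \<open>The cycle sum of \<open>gen_F D i\<close> is homogeneous of total degree 1, and \<phi>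
  maps it to that of \<open>gen_E D i\<close>. The value is therefore a multiple of the rank-one
  form of \<open>G_form_rank_one\<close>.\<close>

lemma (in diagram_lie_algebra) Omega_generators:
  assumes \<phi>: "transposition_antiaut D \<phi>" and "is_Omega D \<phi> J \<psi> \<Omega>" and i: "i \<in> I"
  shows "\<Omega> (cycle_sum (aut D) (ordT D) (gen_E D i)) (cycle_sum (aut D) (ordT D) (gen_F D i)) = 0"
proof -
  let ?F = "cycle_sum (aut D) (ordT D) (gen_F D i)"
  let ?lam = "count_list (map (cycle_of D) [i])"
  have F: "?F \<in> fixed_component D (Minus ?lam)"
    using cycle_sum_commutator[where g = "gen_F D", OF commutator.single[OF i] aut_gen(2)]
    by (simp add: n_minus_deg_def)
  have "clinear \<phi>" "\<And>j. j \<in> I \<Longrightarrow> \<phi> (gen_F D j) = gen_E D j"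
    using \<phi> by (auto simp: transposition_antiaut_def)
  then have "\<phi> ?F = cycle_sum (aut D) (ordT D) (gen_E D i)"
    using perm_funpow_in[OF i]
    by (simp add: cycle_sum_def clinear_sum aut_funpow_gen[OF i] del: atLeastAtMost_iff)
  moreover have lam: "?lam \<in> nonzero_degrees D" and total: "total D ?lam = 1"
    using degree_nonzero[of "[i]"] i by (simp_all del: atLeastAtMost_iff)
  have "\<Omega> (\<phi> ?F) ?F = 0"
    using assms(2)[unfolded is_Omega_def Let_def, THEN conjunct2, THEN conjunct2, THEN conjunct1,
        rule_format, OF lam F F]
    unfolding total G_form_rank_one by simp
  ultimately show ?thesis
    by simp
qed

text \<open>The argument on the fixed points of g, before passing to the quotient. Both \<Omega> and
  \<beta> are linear only there, so every extension by linearity stays inside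
  \<open>?V\<close>.\<close>

lemma (in diagram_lie_algebra) Omega_coboundary_zero:
  assumes \<phi>: "transposition_antiaut D \<phi>" and \<Omega>: "is_Omega D \<phi> J \<psi> \<Omega>"
    and \<beta>: "clinear_on (fixed_points (aut D)) \<beta>"
    and coboundary: "\<And>x y. x \<in> fixed_points (aut D) \<Longrightarrow> y \<in> fixed_points (aut D) \<Longrightarrow>
      \<Omega> x y = \<beta> \<^bold>[x, y\<^bold>]"
    and x: "x \<in> fixed_points (aut D)" and y: "y \<in> fixed_points (aut D)"
  shows "\<Omega> x y = 0"
proof -
  let ?V = "fixed_points (aut D)" and ?s = "cycle_sum (aut D) (ordT D)"
  let ?C = "\<Union>c\<in>components D. fixed_component D c"
  have bilinear: "cbilinear_on ?V \<Omega>"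
    and skew: "\<forall>u\<in>?V. \<forall>v\<in>?V. \<Omega> u v = - \<Omega> v u"
    and orthogonal: "\<forall>c\<in>components D. \<forall>c'\<in>components D.
      (\<nexists>lam. (c = Plus lam \<and> c' = Minus lam) \<or> (c = Minus lam \<and> c' = Plus lam)) \<longrightarrow>
      (\<forall>u\<in>fixed_component D c. \<forall>v\<in>fixed_component D c'. \<Omega> u v = 0)"
    using \<Omega> unfolding is_Omega_def by - (elim conjE, assumption)+
  have V: "cvec.subspace ?V"
    by (rule subspace_fixed_points[OF clinear_aut])
  have s: "?s z \<in> ?V" for z
    using clinear_aut aut_funpow_ordT by (rule cycle_sum_in_fixed_points)
  have component: "fixed_component D c \<subseteq> ?V" for c
    by (cases c) auto
  \<comment> \<open>The cycle sums of the E and F generators pair to 0, while their bracket is a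
    non-zero multiple of \<open>?s (H i)\<close>.\<close>
  have \<beta>_H: "\<beta> (?s (H i)) = 0" if i: "i \<in> I" for i
  proof -
    obtain n :: nat where n: "0 < n"
      "\<^bold>[?s (gen_E D i), ?s (gen_F D i)\<^bold>] = of_nat n *\<^sub>C ?s (H i)"
      by (rule bracket_cycle_sums[OF i])
    have "0 = \<beta> (of_nat n *\<^sub>C ?s (H i))"
      using Omega_generators[OF \<phi> \<Omega> i] coboundary[OF s s] n(2) by metis
    also have "\<dots> = of_nat n * \<beta> (?s (H i))"
      using \<beta> s by (simp add: clinear_on_def scaleC_complex_def)
    finally show ?thesis
      using n(1) by simp
  qed
  have opposite: "\<Omega> u v = 0"
    if "u \<in> fixed_component D (Plus lam)" "v \<in> fixed_component D (Minus lam)" for u v lam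
  proof -
    have "\<beta> \<^bold>[u, v\<^bold>] = 0"
      by (rule clinear_on_span_zero[OF \<beta> V _ bracket_opposite_components[OF that]])
        (use s \<beta>_H in blast)+
    moreover have "u \<in> ?V" "v \<in> ?V"
      using that component by blast+
    ultimately show ?thesis
      by (simp add: coboundary)
  qed
  \<comment> \<open>Only opposite components remain after the vanishing built into
    \<open>is_Omega\<close>; the order Minus, Plus reduces to Plus, Minus by skew-symmetry.\<close>
  have components: "\<Omega> u v = 0" if u: "u \<in> ?C" and v: "v \<in> ?C" for u v
  proof -
    obtain c c' where c: "c \<in> components D" "u \<in> fixed_component D c"
      "c' \<in> components D" "v \<in> fixed_component D c'"
      using u v by blast
    show ?thesis
    proof (cases "\<exists>lam. (c = Plus lam \<and> c' = Minus lam) \<or> (c = Minus lam \<and> c' = Plus lam)")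
      case True
      then consider lam where "c = Plus lam" "c' = Minus lam"
        | lam where "c = Minus lam" "c' = Plus lam"
        by blast
      then show ?thesis
      proof cases
        case 1
        then show ?thesis
          using opposite c by blast
      next
        case 2
        then have "\<Omega> v u = 0"
          using opposite c by blast
        moreover have "u \<in> ?V" "v \<in> ?V"
          using c component by blast+
        ultimately show ?thesis
          using skew[rule_format, of u v] by simp
      qed
    next
      case False
      then show ?thesis
        using orthogonal c by blast
    qed
  qed
  have C: "?C \<subseteq> ?V"
    using component by blast
  have linear: "\<And>u. u \<in> ?V \<Longrightarrow> clinear_on ?V (\<Omega> u)"
      "\<And>v. v \<in> ?V \<Longrightarrow> clinear_on ?V (\<lambda>u. \<Omega> u v)"
    using bilinear unfolding cbilinear_on_def by blast+
  \<comment> \<open>The second argument is extended from components to all fixed points; the first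
    argument follows afterwards.\<close>
  have "\<Omega> u y = 0" if "u \<in> ?C" for u
    by (rule clinear_on_span_zero[OF linear(1) V C fixed_points_span_components[OF y]])
      (use that C components in blast)+
  then show ?thesis
    by (rule clinear_on_span_zero[OF linear(2)[OF y] V C fixed_points_span_components[OF x]])
qed

text \<open>Since \<open>q\<close> intertwines \<open>f\<close> and \<sigma>', all iterates of a
  preimage of \<open>x\<close> are again preimages of \<open>x\<close>, and their average is a fixed
  one. So fixed points of the quotient come from fixed points of g.\<close>

lemma lift_fixed_point:
  assumes "lie_hom_on UNIV q" "surj q" and \<sigma>: "\<forall>x. \<sigma>' (q x) = q (f x)"
    and f: "clinear f" "f ^^ T = id" "0 < T" and x: "x \<in> fixed_points \<sigma>'"
  obtains z where "z \<in> fixed_points f" "q z = x"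
proof -
  have q: "clinear q"
    by (rule lie_hom_clinear[OF assms(1)])
  obtain z where z: "q z = x"
    using \<open>surj q\<close> by (metis surjD)
  have "q ((f ^^ k) z) = x" for k
  proof (induction k)
    case (Suc k)
    have "q ((f ^^ Suc k) z) = \<sigma>' (q ((f ^^ k) z))"
      using \<sigma> by simp
    then show ?case
      using Suc x by (simp add: fixed_points_def)
  qed (simp add: z)
  then have "q (cycle_sum f T z) = of_nat T *\<^sub>C x"
    by (simp add: cycle_sum_def clinear_sum[OF q] cvec.sum_constant_scale)
  then have "q ((1 / of_nat T) *\<^sub>C cycle_sum f T z) = x"
    using \<open>0 < T\<close> by (simp add: clinear_scale[OF q] scaleC_scaleC scaleC_one)
  moreover have "(1 / of_nat T) *\<^sub>C cycle_sum f T z \<in> fixed_points f"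
    using f by (intro cvec.subspace_scale subspace_fixed_points cycle_sum_in_fixed_points)
  ultimately show ?thesis
    using that by blast
qed

theorem proposition8p1:
  fixes D :: "('h::complex_vector, 'g::lie_algebra) diagram_data"
    and \<phi> :: "'g \<Rightarrow> 'g"
    and K :: "'g \<Rightarrow> 'g \<Rightarrow> complex"
    and J :: "(nat \<Rightarrow> nat) \<Rightarrow> 'g \<Rightarrow> (nat \<times> nat) free_lie"
    and \<psi> :: "nat \<Rightarrow> nat \<Rightarrow> (nat \<times> nat) free_lie tens \<Rightarrow> flag_sum"
    and \<Omega> :: "'g \<Rightarrow> 'g \<Rightarrow> complex"
    and q :: "'g \<Rightarrow> 'q::lie_algebra"
    and \<sigma>' :: "'q \<Rightarrow> 'q"
    and \<Omega>' :: "'q \<Rightarrow> 'q \<Rightarrow> complex"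
  assumes "cartan_datum D"
    and "attached_lie_algebra D"
    and "diagram_automorphism D"
    and "cycle_representatives D"
    and "primitive_root_of_unity (ordT D) (omega D)"
    and "transposition_antiaut D \<phi>"
    and "invariant_form D K"
    and "\<forall>lam\<in>nonzero_degrees D. is_jmath D lam (J lam)"
    and "\<forall>m\<ge>1. is_psi (ordT D) (omega D) m (\<psi> m)"
    and "is_Omega D \<phi> J \<psi> \<Omega>"
    and "lie_quotient_map q (form_kernel \<phi> K)"
    and "\<forall>x. \<sigma>' (q x) = q (aut D x)"
    and "\<forall>x\<in>fixed_points (aut D). \<forall>y\<in>fixed_points (aut D). \<Omega>' (q x) (q y) = \<Omega> x y"
    and "coboundary_on (fixed_points \<sigma>') \<Omega>'"
  shows "\<forall>x\<in>fixed_points \<sigma>'. \<forall>y\<in>fixed_points \<sigma>'. \<Omega>' x y = 0"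
proof (intro ballI)
  fix x y assume x: "x \<in> fixed_points \<sigma>'" and y: "y \<in> fixed_points \<sigma>'"
  interpret diagram_lie_algebra D
    by unfold_locales (fact assms)+
  have q: "lie_hom_on UNIV q" "surj q"
    using assms(11) by (simp_all add: lie_quotient_map_def)
  note q_simps = clinear_add[OF lie_hom_clinear[OF q(1)]] clinear_scale[OF lie_hom_clinear[OF q(1)]]
    lie_hom_bracket[OF q(1)]
  obtain \<alpha> where \<alpha>: "clinear_on (fixed_points \<sigma>') \<alpha>"
    and cob: "\<And>x y. x \<in> fixed_points \<sigma>' \<Longrightarrow> y \<in> fixed_points \<sigma>' \<Longrightarrow> \<Omega>' x y = \<alpha> \<^bold>[x, y\<^bold>]"
    using assms(14) by (auto simp: coboundary_on_def)
  have q_fixed: "q z \<in> fixed_points \<sigma>'" if "z \<in> fixed_points (aut D)" for z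
    using that assms(12) by (simp add: fixed_points_def)
  \<comment> \<open>Pulling the primitive \<alpha> back along \<open>q\<close> turns \<Omega> itself
    into a coboundary on the fixed points of \<open>aut D\<close>.\<close>
  have \<beta>: "clinear_on (fixed_points (aut D)) (\<lambda>z. \<alpha> (q z))"
    using \<alpha> q_fixed by (simp add: clinear_on_def q_simps)
  have \<Omega>: "\<Omega> u v = \<alpha> (q \<^bold>[u, v\<^bold>])"
    if "u \<in> fixed_points (aut D)" "v \<in> fixed_points (aut D)" for u v
    using that assms(13) cob[OF q_fixed q_fixed] by (simp add: q_simps)
  \<comment> \<open>The link between \<Omega>' and \<Omega> is given on images of fixed points, so
    \<open>x\<close> and \<open>y\<close> are lifted to fixed points rather than to arbitrary
    preimages.\<close>
  obtain u where u: "u \<in> fixed_points (aut D)" "q u = x"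
    by (rule lift_fixed_point[OF q assms(12) clinear_aut aut_funpow_ordT ordT_pos x])
  obtain v where v: "v \<in> fixed_points (aut D)" "q v = y"
    by (rule lift_fixed_point[OF q assms(12) clinear_aut aut_funpow_ordT ordT_pos y])
  have "\<Omega> u v = 0"
    by (rule Omega_coboundary_zero[OF assms(6,10) \<beta> \<Omega> u(1) v(1)])
  then show "\<Omega>' x y = 0"
    using assms(13)[rule_format, OF u(1) v(1)] u(2) v(2) by simp
qed

end
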